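(* Let $N\ge2$ be an integer and let $\tilde Y:=\{\frac{\pi}{N}(2j-1)\}_{j=1}^N\subset(0,2\pi)$. Let $Y=\{y_j\}_{j=1}^N$ with $0<y_1<\cdots<y_N<2\pi$ be an $N$-point set that is not congruent with $\tilde Y$. Then $$\lambda_1(\alpha,Y)<\lambda_1(\alpha,\tilde Y)$$ holds for all $\alpha$ large enough, i.e. there is $\alpha_1>0$ such that the inequality holds for all $\alpha>\alpha_1$. Here $\lambda_1(\alpha,Y)$ is the lowest eigenvalue of the operator $H_{\alpha,Y}$ describing $N$ point interactions of strength $\alpha$ located at the points of $Y$ on a loop of length $2\pi$.
   Context: Let $I=(0,2\pi)$. For $\alpha\in\mathbb{R}$ and $Y=\{y_j\}_{j=1}^N$ with $0<y_1<\cdots<y_N<2\pi$, the operator $H_{\alpha,Y}$, formally $-\frac{\mathrm{d}^2}{\mathrm{d}x^2}+\alpha\sum_{j=1}^N\delta(x-y_j)$ with periodic boundary conditions, is the unique self-adjoint operator in $L^2(I)$ associated with the quadratic form $$q_{\alpha,Y}(\psi)=\|\psi'\|^2+\alpha\sum_{j=1}^N|\psi(y_j)|^2$$ defined on the functions $\psi\in H^1(I)$ with $\psi(0+)=\psi(2\pi-)$. Equivalently, it acts as $-\psi''$ away from $Y$ on functions that are $H^2$ on each component of $I\setminus Y$ and satisfy $\psi(y_j+)=\psi(y_j-)=:\psi(y_j)$ and $\psi'(y_j+)-\psi'(y_j-)=\alpha\psi(y_j)$ for $j=1,\dots,N$, together with $\psi(2\pi-)=\psi(0+)$ and $\psi'(2\pi-)=\psi'(0+)$.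 Its spectrum is purely discrete; $\lambda_1(\alpha,Y)$ denotes its smallest eigenvalue. Two $N$-point sets are called congruent if, viewed as subsets of the loop $\mathbb{R}/2\pi\mathbb{Z}$ with its arc-length metric, one is mapped onto the other by an isometry of the loop. *)

theory Defs
  imports "HOL-Analysis.Analysis"
begin

text \<open>
  Elements of \<open>L\<^sup>2(0,2\<pi>)\<close> are represented by functions on the real line; only their values
  on the open interval matter, up to null sets.
\<close>

definition I2pi :: "real set"
  where "I2pi = {0<..<2 * pi}"

definition L2I :: "(real \<Rightarrow> complex) set"
  where "L2I = {f. set_borel_measurable lebesgue I2pi f \<and>
                   set_integrable lebesgue I2pi (\<lambda>x. (cmod (f x))\<^sup>2)}"

definition L2I_inner :: "(real \<Rightarrow> complex) \<Rightarrow> (real \<Rightarrow> complex) \<Rightarrow> complex"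
  where "L2I_inner f g = (LINT x:I2pi|lebesgue. cnj (f x) * g x)"

text \<open>
  \<open>\<psi>\<close> is locally absolutely continuous on the open interval with derivative \<open>g\<close> almost everywhere,
  i.e. \<open>\<psi>\<close> is the continuous representative of its class and \<open>g\<close> its weak derivative.
  The representative has to be fixed because the form evaluates \<open>\<psi>\<close> at points.
\<close>

definition has_weak_deriv :: "(real \<Rightarrow> complex) \<Rightarrow> (real \<Rightarrow> complex) \<Rightarrow> bool"
  where "has_weak_deriv \<psi> g \<longleftrightarrow>
    (\<forall>a\<in>I2pi. \<forall>b\<in>I2pi. a \<le> b \<longrightarrow>
       set_integrable lebesgue {a..b} g \<and> \<psi> b - \<psi> a = (LINT x:{a..b}|lebesgue. g x))"

definition H1I :: "(real \<Rightarrow> complex) set"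
  where "H1I = {\<psi> \<in> L2I. \<exists>g\<in>L2I. has_weak_deriv \<psi> g}"

text \<open>The weak derivative is determined only almost everywhere; see \<open>has_weak_deriv_unique\<close>.\<close>

definition weak_deriv :: "(real \<Rightarrow> complex) \<Rightarrow> real \<Rightarrow> complex"
  where "weak_deriv \<psi> = (SOME g. g \<in> L2I \<and> has_weak_deriv \<psi> g)"

lemma has_weak_deriv_unique:
  assumes "has_weak_deriv \<psi> g" and "has_weak_deriv \<psi> h"
  shows "AE x in lebesgue. x \<in> I2pi \<longrightarrow> g x = h x"
proof -
  define d where "d x = g x - h x" for x
  have int0: "set_integrable lebesgue {a..b} d \<and> (LINT x:{a..b}|lebesgue. d x) = 0"
    if "a \<in> I2pi" "b \<in> I2pi" "a \<le> b" for a b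
    using assms that unfolding has_weak_deriv_def d_def by (auto simp: set_integral_diff)
  have loc: "AE x in lebesgue. x \<in> {a..b} \<longrightarrow> d x = 0"
    if ab: "a \<in> I2pi" "b \<in> I2pi" "a \<le> b" for a b
  proof -
    define f where "f x = indicator {a..b} x *\<^sub>R d x" for x
    have fint: "integrable lebesgue f"
      using int0[OF ab] unfolding f_def set_integrable_def by auto
    have zero: "(LINT x:{u..v}|lebesgue. f x) = 0" for u v
    proof (cases "max a u \<le> min b v")
      case True
      then have "max a u \<in> I2pi" "min b v \<in> I2pi"
        using ab True max.cobounded1[of a u] min.cobounded1[of b v]
        unfolding I2pi_def greaterThanLessThan_iff by linarith+
      then have "(LINT x:{max a u..min b v}|lebesgue. d x) = 0"
        using int0 True by blast
      also have "(LINT x:{max a u..min b v}|lebesgue. d x) = (LINT x:{u..v}|lebesgue. f x)"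
        unfolding set_lebesgue_integral_def f_def
        by (intro Bochner_Integration.integral_cong) (auto simp: indicator_def)
      finally show ?thesis .
    next
      case False
      then have "(\<lambda>x. indicator {u..v} x *\<^sub>R f x) = (\<lambda>x. 0)"
        by (auto simp: f_def indicator_def fun_eq_iff)
      then show ?thesis
        unfolding set_lebesgue_integral_def by (simp only: integral_zero)
    qed
    have total: "integral\<^sup>L lebesgue f = 0"
    proof -
      have "integral\<^sup>L lebesgue f = (LINT x:{a..b}|lebesgue. f x)"
        unfolding set_lebesgue_integral_def f_def
        by (intro Bochner_Integration.integral_cong) (auto simp: indicator_def)
      then show ?thesis using zero by simp
    qed
    have borel0: "(LINT x:A|lebesgue. f x) = 0" if "A \<in> sets borel" for A
      using that
    proof (induction A rule: borel_set_induct)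
      case empty
      show ?case by (simp add: set_lebesgue_integral_def)
    next
      case (interval u v)
      show ?case by (rule zero)
    next
      case (compl A)
      have fi: "set_integrable lebesgue B f" if "B \<in> sets borel" for B
        using fint that by (auto simp: set_integrable_def intro!: integrable_mult_indicator)
      have "(LINT x:A \<union> - A|lebesgue. f x) = (LINT x:A|lebesgue. f x) + (LINT x:- A|lebesgue. f x)"
        using compl(1) by (intro set_integral_Un fi) auto
      then show ?case
        using compl total by (simp add: set_lebesgue_integral_def)
    next
      case (union F)
      have "(LINT x:(\<Union>i. F i)|lebesgue. f x) = (\<Sum>i. (LINT x:(F i)|lebesgue. f x))"
      proof (rule lebesgue_integral_countable_add)
        show "F i \<in> sets lebesgue" for i using union(2) by auto
        show "F i \<inter> F j = {}" if "i \<noteq> j" for i j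
          using union(1) that by (auto simp: disjoint_family_on_def)
        have "(\<Union>i. F i) \<in> sets lebesgue" using union(2) by auto
        then show "set_integrable lebesgue (\<Union>i. F i) f"
          using fint by (auto simp: set_integrable_def intro!: integrable_mult_indicator)
      qed
      then show ?case using union(3) by simp
    qed
    have sf: "sigma_finite_measure (lebesgue :: real measure)"
    proof
      obtain C :: "real set set" where "countable C" "C \<subseteq> sets lborel" "\<Union>C = space lborel"
          "\<forall>a\<in>C. emeasure lborel a \<noteq> \<infinity>"
        using lborel.sigma_finite_countable by blast
      then show "\<exists>C :: real set set. countable C \<and> C \<subseteq> sets lebesgue \<and> \<Union>C = space lebesgue \<and>
          (\<forall>a\<in>C. emeasure lebesgue a \<noteq> \<infinity>)"
        by (intro exI[of _ C]) (auto intro: sets_completionI_sets)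
    qed
    have "AE x in lebesgue. f x = 0"
    proof (rule sigma_finite_measure.density_zero[OF sf fint])
      fix A :: "real set" assume A: "A \<in> sets lebesgue"
      have mp: "main_part lborel A \<in> sets borel"
        using main_part_sets[OF A] by simp
      obtain N where N: "N \<in> null_sets lborel" "null_part lborel A \<subseteq> N"
        using null_part[OF A] by blast
      have nn: "N \<in> null_sets lebesgue" using N(1) null_sets_completionI by blast
      have ae: "AE x in lebesgue. x \<in> A \<longleftrightarrow> x \<in> main_part lborel A"
        using AE_not_in[OF nn]
      proof eventually_elim
        case (elim x)
        then show ?case
          using main_part_null_part_Un[OF A] N(2) by blast
      qed
      have m: "main_part lborel A \<in> sets lebesgue" using mp by simp
      have "(LINT x:A|lebesgue. f x) = (LINT x:main_part lborel A|lebesgue. f x)"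
        by (rule set_integral_cong_set)
           (use A m ae fint in \<open>auto simp: set_borel_measurable_def
              intro!: borel_measurable_scaleR borel_measurable_indicator elim: eventually_mono\<close>)
      then show "(LINT x:A|lebesgue. f x) = 0"
        using borel0[OF mp] by simp
    qed
    then show ?thesis by eventually_elim (auto simp: f_def indicator_def)
  qed
  have "AE x in lebesgue. \<forall>n. x \<in> {1 / Suc n..2 * pi - 1 / Suc n} \<longrightarrow> d x = 0"
    unfolding AE_all_countable
  proof
    fix n
    show "AE x in lebesgue. x \<in> {1 / Suc n..2 * pi - 1 / Suc n} \<longrightarrow> d x = 0"
    proof (rule loc)
      define r where "r = 1 / real (Suc n)"
      have "0 < r" "r \<le> 1" unfolding r_def by (auto simp: field_simps)
      then have "0 < r" "r < pi" using pi_gt3 by linarith+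
      then have "r \<in> I2pi" "2 * pi - r \<in> I2pi" "r \<le> 2 * pi - r"
        by (auto simp: I2pi_def)
      then show "1 / Suc n \<in> I2pi" "2 * pi - 1 / Suc n \<in> I2pi" "1 / Suc n \<le> 2 * pi - 1 / Suc n"
        by (simp_all only: r_def)
    qed
  qed
  then show ?thesis
  proof eventually_elim
    case (elim x)
    show ?case
    proof
      assume "x \<in> I2pi"
      then have "0 < min x (2 * pi - x)" by (auto simp: I2pi_def)
      then obtain n where "1 / real (Suc n) < min x (2 * pi - x)"
        using nat_approx_posE by blast
      then have "x \<in> {1 / Suc n..2 * pi - 1 / Suc n}" by auto
      with elim show "g x = h x" by (auto simp: d_def)
    qed
  qed
qed

definition delta_form_dom :: "(real \<Rightarrow> complex) set"
  where "delta_form_dom =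
    {\<psi> \<in> H1I. \<exists>c. (\<psi> \<longlongrightarrow> c) (at_right 0) \<and> (\<psi> \<longlongrightarrow> c) (at_left (2 * pi))}"

text \<open>The sesquilinear form (antilinear in the first argument) whose quadratic form is \<open>q\<^bsub>\<alpha>,Y\<^esub>\<close>.\<close>

definition delta_form :: "real \<Rightarrow> real set \<Rightarrow> (real \<Rightarrow> complex) \<Rightarrow> (real \<Rightarrow> complex) \<Rightarrow> complex"
  where "delta_form \<alpha> Y \<phi> \<psi> =
    L2I_inner (weak_deriv \<phi>) (weak_deriv \<psi>) + of_real \<alpha> * (\<Sum>p\<in>Y. cnj (\<phi> p) * \<psi> p)"

lemma delta_form_diagonal:
  "delta_form \<alpha> Y \<psi> \<psi> = of_real
     ((LINT x:I2pi|lebesgue. (cmod (weak_deriv \<psi> x))\<^sup>2) + \<alpha> * (\<Sum>p\<in>Y. (cmod (\<psi> p))\<^sup>2))"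
proof -
  have *: "cnj z * z = of_real ((cmod z)\<^sup>2)" for z
    by (metis complex_norm_square mult.commute of_real_power)
  show ?thesis
    unfolding delta_form_def L2I_inner_def * set_integral_complex_of_real by simp
qed

text \<open>
  The operator associated with a sesquilinear form \<open>t\<close> on the domain \<open>D\<close>, as a graph:
  \<open>\<psi>\<close> is in its domain and is mapped to \<open>f\<close> iff \<open>t(\<eta>, \<psi>) = \<langle>\<eta>, f\<rangle>\<close> for all \<open>\<eta> \<in> D\<close>.
\<close>

definition form_operator ::
  "(real \<Rightarrow> complex) set \<Rightarrow> ((real \<Rightarrow> complex) \<Rightarrow> (real \<Rightarrow> complex) \<Rightarrow> complex) \<Rightarrow>
   ((real \<Rightarrow> complex) \<times> (real \<Rightarrow> complex)) set"
  where "form_operator D t =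
    {(\<psi>, f). \<psi> \<in> D \<and> f \<in> L2I \<and> (\<forall>\<eta>\<in>D. t \<eta> \<psi> = L2I_inner \<eta> f)}"

definition delta_operator ::
  "real \<Rightarrow> real set \<Rightarrow> ((real \<Rightarrow> complex) \<times> (real \<Rightarrow> complex)) set"
  where "delta_operator \<alpha> Y = form_operator delta_form_dom (delta_form \<alpha> Y)"

definition is_eigenvalue ::
  "((real \<Rightarrow> complex) \<times> (real \<Rightarrow> complex)) set \<Rightarrow> complex \<Rightarrow> bool"
  where "is_eigenvalue H \<mu> \<longleftrightarrow>
    (\<exists>\<psi>. (\<psi>, \<lambda>x. \<mu> * \<psi> x) \<in> H \<and> \<not> (AE x in lebesgue. x \<in> I2pi \<longrightarrow> \<psi> x = 0))"

definition lambda1 :: "real \<Rightarrow> real set \<Rightarrow> real"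
  where "lambda1 \<alpha> Y = (LEAST \<mu>. is_eigenvalue (delta_operator \<alpha> Y) (of_real \<mu>))"

text \<open>The loop \<open>\<real>/2\<pi>\<int>\<close>, with points represented in \<open>[0, 2\<pi>)\<close>.\<close>

definition loop :: "real set"
  where "loop = {0..<2 * pi}"

definition loop_dist :: "real \<Rightarrow> real \<Rightarrow> real"
  where "loop_dist s t = min \<bar>s - t\<bar> (2 * pi - \<bar>s - t\<bar>)"

definition loop_isometry :: "(real \<Rightarrow> real) \<Rightarrow> bool"
  where "loop_isometry f \<longleftrightarrow>
    bij_betw f loop loop \<and> (\<forall>s\<in>loop. \<forall>t\<in>loop. loop_dist (f s) (f t) = loop_dist s t)"

definition loop_congruent :: "real set \<Rightarrow> real set \<Rightarrow> bool"
  where "loop_congruent A B \<longleftrightarrow> (\<exists>f. loop_isometry f \<and> f ` A = B)"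

definition Ytilde :: "nat \<Rightarrow> real set"
  where "Ytilde N = (\<lambda>j. pi / real N * (2 * real j - 1)) ` {1..N}"

end

theory Submission
  imports Defs
begin

text \<open>
  If \<open>Y\<close> is not congruent with the equidistant set, some arc between neighbouring points has length
  \<open>\<ell> > 2 \<pi> / N\<close>. The Dirichlet sine on that arc does not feel the interaction, so
  \<open>\<lambda>\<^sub>1(\<alpha>, Y) \<le> (\<pi> / \<ell>)\<^sup>2 < N\<^sup>2 / 4\<close> for every \<open>\<alpha>\<close>. For the equidistant set, comparison with
  \<open>cos (K (x - m))\<close> on each arc (\<open>m\<close> its midpoint) shows that no eigenvalue is smaller than \<open>K\<^sup>2\<close> once
  \<open>\<alpha> \<ge> 2 K tan (K \<pi> / N)\<close>, for any \<open>K < N / 2\<close>.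

  The existence of a least eigenvalue is a finite-dimensional question: minimising
  \<open>q(\<psi>) - \<kappa>\<^sup>2 \<parallel>\<psi>\<parallel>\<^sup>2\<close> for given values at finitely many vertices leaves a quadratic form in these
  values. At the first \<open>\<kappa>\<close> where it degenerates, a null vector yields a positive eigenfunction \<open>u\<close>, and
  completing the square with the Riccati variable \<open>u' / u\<close> shows that \<open>\<kappa>\<^sup>2\<close> is the least eigenvalue.
\<close>

section \<open>Absolutely continuous functions\<close>

text \<open>\<open>lambda1\<close> is a \<open>LEAST\<close>, so estimates for eigenvalues determine
  nothing until a smallest eigenvalue is known to exist; this obstacle shapes most of the
  development. No compactness of resolvents enters: between vertices everything is explicit, and
  only a bounded set of vertex vectors and of values \<kappa> has to be compact. The reduction needs
  \<kappa> times every arc length to stay below \<pi>, since at \<pi> an arc carries a Dirichlet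
  solution and interpolation breaks down. With vertices at \<open>Y\<close> alone this happens
  exactly at \<kappa> = \<pi> / \<ell>, the value to be tested, hence the extra vertices inside the
  arcs. The same completion of the square serves twice: with the logarithmic derivative of the
  constructed eigenfunction it shows minimality, with a tangent it gives the explicit lower bound.
  Strictness comes from fixing \<open>K\<close> strictly between \<pi> / \<ell> and
  \<open>N / 2\<close>, so the estimate for \<open>Y\<close> may itself be weak.\<close>

definition ac_on :: "real \<Rightarrow> real \<Rightarrow> (real \<Rightarrow> complex) \<Rightarrow> (real \<Rightarrow> complex) \<Rightarrow> bool"
  where "ac_on a b F f \<longleftrightarrow>
    f absolutely_integrable_on {a..b} \<and> (\<forall>x\<in>{a..b}. F x = F a + integral {a..x} f)"

lemma ac_on_continuous:
  assumes "ac_on a b F f"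
  shows "continuous_on {a..b} F"
proof -
  have "continuous_on {a..b} (\<lambda>x. F a + integral {a..x} f)"
    using assms unfolding ac_on_def
    by (intro continuous_intros indefinite_integral_continuous_1) (auto dest: set_lebesgue_integral_eq_integral)
  then show ?thesis
    using assms unfolding ac_on_def by (metis (no_types, lifting) continuous_on_eq)
qed

lemma ac_on_subinterval:
  assumes "ac_on a b F f" "a \<le> c" "c \<le> d" "d \<le> b"
  shows "ac_on c d F f"
  unfolding ac_on_def
proof (intro conjI ballI)
  have f: "f absolutely_integrable_on {a..b}" using assms ac_on_def by auto
  then show "f absolutely_integrable_on {c..d}"
    by (rule absolutely_integrable_on_subinterval) (use assms in auto)
  fix x assume x: "x \<in> {c..d}"
  have "f absolutely_integrable_on {a..x}"
    by (rule absolutely_integrable_on_subinterval[OF f]) (use assms x in auto)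
  then have "f integrable_on {a..x}" by (rule set_lebesgue_integral_eq_integral)
  then have "integral {a..c} f + integral {c..x} f = integral {a..x} f"
    using assms x by (intro Henstock_Kurzweil_Integration.integral_combine) auto
  moreover have "F x = F a + integral {a..x} f" "F c = F a + integral {a..c} f"
    using assms x unfolding ac_on_def by (metis atLeastAtMost_iff order_trans)+
  ultimately show "F x = F c + integral {c..x} f" by simp
qed

lemma absolutely_integrable_continuous_mult:
  fixes f F :: "real \<Rightarrow> complex"
  assumes "continuous_on {a..b} F" "f absolutely_integrable_on {a..b}"
  shows "(\<lambda>x. F x * f x) absolutely_integrable_on {a..b}"
proof (rule absolutely_integrable_bounded_measurable_product[of "(*)"])
  show "bounded (F ` {a..b})"
    using assms by (intro compact_imp_bounded compact_continuous_image) auto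
  show "F \<in> borel_measurable (lebesgue_on {a..b})"
    using assms by (intro continuous_imp_measurable_on_sets_lebesgue) auto
qed (use assms in \<open>auto simp: bilinear_times\<close>)

text \<open>
  Integration by parts in disguise: Fubini on the square, cut along its diagonal.
\<close>

lemma product_integral_split:
  fixes f g :: "real \<Rightarrow> complex"
  assumes f: "f absolutely_integrable_on {a..b}" and g: "g absolutely_integrable_on {a..b}"
  shows "integral {a..b} f * integral {a..b} g =
    integral {a..b} (\<lambda>x. f x * integral {a..x} g) + integral {a..b} (\<lambda>x. integral {a..x} f * g x)"
proof -
  define M where "M = lebesgue_on {a..b}"
  interpret M: finite_measure M
    unfolding M_def by (rule finite_measure_lebesgue_on) auto
  interpret P: pair_sigma_finite M M ..
  have fM: "integrable M f" and gM: "integrable M g"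
    using f g unfolding M_def by (auto simp: absolutely_integrable_on_def integrable_restrict_space set_integrable_def)
  have [measurable]: "f \<in> borel_measurable M" "g \<in> borel_measurable M"
    using fM gM by auto
  have [measurable]: "(\<lambda>x. x) \<in> borel_measurable M" unfolding M_def by (intro continuous_imp_measurable_on_sets_lebesgue continuous_intros) auto
  define H where "H = (\<lambda>(x, t). f x * g t)"
  have [measurable]: "H \<in> borel_measurable (M \<Otimes>\<^sub>M M)" unfolding H_def by measurable
  have H: "integrable (M \<Otimes>\<^sub>M M) H"
  proof (rule P.Fubini_integrable)
    show "integrable M (\<lambda>x. LINT y|M. norm (H (x, y)))"
      using fM gM by (simp add: H_def norm_mult)
  qed (use fM gM in \<open>auto simp: H_def\<close>)
  \<comment> \<open>The diagonal is given to \<open>H1\<close>. The inner integral belonging to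
    \<open>H2\<close> therefore runs over a half-open interval, and \<open>inner2\<close> has to add
    a single point.\<close>
  define H1 where "H1 = (\<lambda>z::real\<times>real. if fst z \<le> snd z then H z else 0)"
  define H2 where "H2 = (\<lambda>z::real\<times>real. if snd z < fst z then H z else 0)"
  have H1: "integrable (M \<Otimes>\<^sub>M M) H1" and H2: "integrable (M \<Otimes>\<^sub>M M) H2"
    unfolding H1_def H2_def
    by (rule Bochner_Integration.integrable_bound[OF H]; (measurable | force))+
  have LI: "(LINT x|M. h x) = integral {a..b} h" if "integrable M h" for h :: "real \<Rightarrow> complex"
    using that unfolding M_def by (intro lebesgue_integral_eq_integral) auto
  have sub: "integrable (lebesgue_on {a..x}) h" if "h absolutely_integrable_on {a..b}" "x \<in> {a..b}" for h :: "real \<Rightarrow> complex" and x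
    using absolutely_integrable_on_subinterval[OF that(1), of a x] that
    by (auto simp: integrable_restrict_space set_integrable_def)
  have inner1: "(LINT x|M. (if x \<le> t then f x else 0)) = integral {a..t} f" if "t \<in> {a..b}" for t
  proof -
    have "(LINT x|M. (if x \<le> t then f x else 0)) = integral\<^sup>L (lebesgue_on {a..t}) f"
      unfolding M_def using that
      by (simp add: integral_restrict_space, intro Bochner_Integration.integral_cong) (auto simp: indicator_def)
    then show ?thesis using lebesgue_integral_eq_integral[OF sub[OF f that]] by simp
  qed
  have inner2: "(LINT t|M. (if t < x then g t else 0)) = integral {a..x} g" if "x \<in> {a..b}" for x
  proof -
    have "(LINT t|M. (if t < x then g t else 0)) = integral\<^sup>L (lebesgue_on {a..<x}) g"
      unfolding M_def using that
      by (simp add: integral_restrict_space, intro Bochner_Integration.integral_cong) (auto simp: indicator_def)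
    also have "\<dots> = integral\<^sup>L (lebesgue_on {a..x}) g"
    proof -
      have sb: "{a..<x} \<subseteq> {a..b}" using that by auto
      have "AE t in lebesgue. t \<noteq> x"
        by (rule AE_I'[of "{x}"]) auto
      then show ?thesis
        using sub[OF g that] set_integrable_subset[OF g _ sb]
        by (simp add: integral_restrict_space set_integrable_def integrable_restrict_space, intro integral_cong_AE)
          (auto simp: indicator_def elim!: eventually_mono)
    qed
    finally show ?thesis using lebesgue_integral_eq_integral[OF sub[OF g that]] by simp
  qed
  have "integral {a..b} f * integral {a..b} g = (LINT x|M. f x) * (LINT t|M. g t)"
    using LI fM gM by simp
  also have "\<dots> = (LINT x|M. LINT t|M. H (x, t))"
    by (simp add: H_def)
  also have "\<dots> = integral\<^sup>L (M \<Otimes>\<^sub>M M) H"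
    using P.integral_fst'[OF H] by simp
  also have "H = (\<lambda>z. H1 z + H2 z)"
    by (auto simp: H1_def H2_def fun_eq_iff)
  also have "integral\<^sup>L (M \<Otimes>\<^sub>M M) (\<lambda>z. H1 z + H2 z) = integral\<^sup>L (M \<Otimes>\<^sub>M M) H1 + integral\<^sup>L (M \<Otimes>\<^sub>M M) H2"
    by (rule Bochner_Integration.integral_add[OF H1 H2])
  also have "integral\<^sup>L (M \<Otimes>\<^sub>M M) H1 = (LINT t|M. LINT x|M. H1 (x, t))"
    using P.integral_snd[of "\<lambda>x t. H1 (x, t)"] H1 by simp
  also have "\<dots> = (LINT t|M. integral {a..t} f * g t)"
  proof (rule Bochner_Integration.integral_cong)
    fix t assume "t \<in> space M"
    then have t: "t \<in> {a..b}" by (simp add: M_def)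
    have "(LINT x|M. H1 (x, t)) = (LINT x|M. (if x \<le> t then f x else 0) * g t)"
      by (rule Bochner_Integration.integral_cong) (auto simp: H1_def H_def)
    then show "(LINT x|M. H1 (x, t)) = integral {a..t} f * g t"
      using inner1[OF t] by simp
  qed simp
  also have "\<dots> = integral {a..b} (\<lambda>t. integral {a..t} f * g t)"
    by (rule LI, unfold M_def)
      (use absolutely_integrable_continuous_mult[OF _ g, of "\<lambda>t. integral {a..t} f"]
        indefinite_integral_continuous_1[OF set_lebesgue_integral_eq_integral(1)[OF f]]
        in \<open>simp add: integrable_restrict_space set_integrable_def\<close>)
  also have "integral\<^sup>L (M \<Otimes>\<^sub>M M) H2 = (LINT x|M. LINT t|M. H2 (x, t))"
    using P.integral_fst'[OF H2] by simp
  also have "\<dots> = (LINT x|M. f x * integral {a..x} g)"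
  proof (rule Bochner_Integration.integral_cong)
    fix t assume "t \<in> space M"
    then have t: "t \<in> {a..b}" by (simp add: M_def)
    have "(LINT x|M. H2 (t, x)) = (LINT x|M. f t * (if x < t then g x else 0))"
      by (rule Bochner_Integration.integral_cong) (auto simp: H2_def H_def)
    then show "(LINT x|M. H2 (t, x)) = f t * integral {a..t} g"
      using inner2[OF t] by simp
  qed simp
  also have "\<dots> = integral {a..b} (\<lambda>t. f t * integral {a..t} g)"
    by (rule LI, unfold M_def)
      (use absolutely_integrable_continuous_mult[OF _ f, of "\<lambda>t. integral {a..t} g"]
        indefinite_integral_continuous_1[OF set_lebesgue_integral_eq_integral(1)[OF g]]
        in \<open>simp add: integrable_restrict_space set_integrable_def mult.commute\<close>)
  finally show ?thesis by simp
qed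

text \<open>Writing both factors as initial value plus indefinite integral leaves, besides terms
  linear in one of the integrals, exactly the two integrals that
  \<open>product_integral_split\<close> combines into a product. Differentiability almost everywhere
  is never invoked.\<close>

lemma ac_on_mult:
  assumes F: "ac_on a b F f" and G: "ac_on a b G g"
  shows "ac_on a b (\<lambda>x. F x * G x) (\<lambda>x. f x * G x + F x * g x)"
  unfolding ac_on_def
proof (intro conjI ballI)
  have int: "(\<lambda>x. f x * G x) absolutely_integrable_on {a..b}"
            "(\<lambda>x. F x * g x) absolutely_integrable_on {a..b}"
    if "ac_on a b F f" "ac_on a b G g" for a b
    using that absolutely_integrable_continuous_mult[OF ac_on_continuous[OF that(1)], of g]
      absolutely_integrable_continuous_mult[OF ac_on_continuous[OF that(2)], of f]
    by (auto simp: ac_on_def mult.commute)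
  show "(\<lambda>x. f x * G x + F x * g x) absolutely_integrable_on {a..b}"
    using int[OF F G] by (rule set_integral_add)
  fix x assume x: "x \<in> {a..b}"
  have F': "ac_on a x F f" and G': "ac_on a x G g"
    using ac_on_subinterval[OF F, of a x] ac_on_subinterval[OF G, of a x] x by auto
  have f: "f absolutely_integrable_on {a..x}" and g: "g absolutely_integrable_on {a..x}"
    using F' G' ac_on_def by auto
  have FE: "F t = F a + integral {a..t} f" if "t \<in> {a..x}" for t using F' that unfolding ac_on_def by blast
  have GE: "G t = G a + integral {a..t} g" if "t \<in> {a..x}" for t using G' that unfolding ac_on_def by blast
  note si = set_lebesgue_integral_eq_integral(1)
  have ci: "continuous_on {a..x} (\<lambda>t. integral {a..t} f)" "continuous_on {a..x} (\<lambda>t. integral {a..t} g)"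
    using indefinite_integral_continuous_1 si f g by blast+
  have i1: "(\<lambda>t. f t * integral {a..t} g) integrable_on {a..x}"
    using si[OF absolutely_integrable_continuous_mult[OF ci(2) f]] by (simp add: mult.commute)
  have i2: "(\<lambda>t. integral {a..t} f * g t) integrable_on {a..x}"
    using si[OF absolutely_integrable_continuous_mult[OF ci(1) g]] .
  have "integral {a..x} (\<lambda>t. f t * G t + F t * g t) = 
     integral {a..x} (\<lambda>t. (f t * G a + f t * integral {a..t} g) + (F a * g t + integral {a..t} f * g t))"
    by (rule integral_cong, subst FE, simp, subst GE, simp) (simp add: algebra_simps)
  also have "\<dots> = (integral {a..x} f * G a + integral {a..x} (\<lambda>t. f t * integral {a..t} g))
     + (F a * integral {a..x} g + integral {a..x} (\<lambda>t. integral {a..t} f * g t))"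
    using si[OF f] si[OF g] i1 i2
    by (simp add: Henstock_Kurzweil_Integration.integral_add integrable_add integrable_on_mult_right integrable_on_mult_left)
  also have "\<dots> = integral {a..x} f * G a + F a * integral {a..x} g + integral {a..x} f * integral {a..x} g"
    using product_integral_split[OF f g] by simp
  finally show "F x * G x = F a * G a + integral {a..x} (\<lambda>t. f t * G t + F t * g t)"
    using FE[of x] GE[of x] x by (simp add: algebra_simps)
qed

lemma ac_on_cnj:
  assumes "ac_on a b F f"
  shows "ac_on a b (\<lambda>x. cnj (F x)) (\<lambda>x. cnj (f x))"
  unfolding ac_on_def
proof (intro conjI ballI)
  have f: "f absolutely_integrable_on {a..b}" using assms ac_on_def by auto
  show "(\<lambda>x. cnj (f x)) absolutely_integrable_on {a..b}"
    using f unfolding set_integrable_def by (auto dest: integrable_cnj)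
  fix x assume "x \<in> {a..b}"
  then have "F x = F a + integral {a..x} f" using assms unfolding ac_on_def by blast
  then show "cnj (F x) = cnj (F a) + integral {a..x} (\<lambda>x. cnj (f x))"
    by (simp flip: integral_cnj)
qed

lemma ac_on_C1:
  assumes "\<And>x. x \<in> {a..b} \<Longrightarrow> (F has_vector_derivative f x) (at x within {a..b})"
    and "continuous_on {a..b} f"
  shows "ac_on a b F f"
  unfolding ac_on_def
proof (intro conjI ballI)
  show "f absolutely_integrable_on {a..b}"
    using assms(2) by (rule absolutely_integrable_continuous_real)
  fix x assume x: "x \<in> {a..b}"
  have "(f has_integral (F x - F a)) {a..x}"
    using x by (intro fundamental_theorem_of_calculus has_vector_derivative_within_subset[OF assms(1)]) auto
  then show "F x = F a + integral {a..x} f" by (simp add: integral_unique)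
qed

text \<open>
  \<open>w\<close> plays the role of \<open>u'/u\<close> for a positive solution of \<open>- u'' = \<kappa>\<^sup>2 u\<close>; the difference of the two sides
  is the integral of \<open>\<bar>\<psi>' - w \<psi>\<bar>\<^sup>2\<close>.
\<close>

lemma riccati_energy:
  assumes \<psi>: "ac_on a b \<psi> g" and g: "(\<lambda>x. (cmod (g x))\<^sup>2) absolutely_integrable_on {a..b}"
    and "a \<le> b"
    and w: "\<And>x. x \<in> {a..b} \<Longrightarrow> (w has_real_derivative - \<kappa>\<^sup>2 - (w x)\<^sup>2) (at x)"
  shows "w b * (cmod (\<psi> b))\<^sup>2 - w a * (cmod (\<psi> a))\<^sup>2
    \<le> integral {a..b} (\<lambda>x. (cmod (g x))\<^sup>2) - \<kappa>\<^sup>2 * integral {a..b} (\<lambda>x. (cmod (\<psi> x))\<^sup>2)"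
proof -
  note si = set_lebesgue_integral_eq_integral(1)
  have cw: "continuous_on {a..b} w"
    using w by (intro continuous_at_imp_continuous_on ballI) (rule DERIV_isCont)
  have W: "ac_on a b (\<lambda>x. complex_of_real (w x)) (\<lambda>x. complex_of_real (- \<kappa>\<^sup>2 - (w x)\<^sup>2))"
  proof (rule ac_on_C1)
    fix x assume "x \<in> {a..b}"
    then show "((\<lambda>x. complex_of_real (w x)) has_vector_derivative complex_of_real (- \<kappa>\<^sup>2 - (w x)\<^sup>2)) (at x within {a..b})"
      using w by (intro has_vector_derivative_of_real) (auto intro: has_field_derivative_at_within)
  qed (intro continuous_intros cw)
  \<comment> \<open>The derivative of \<open>w\<close> times the squared modulus of \<psi>, with the
    derivative of \<open>w\<close> replaced through the Riccati equation. The product rule is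
    available for complex values, so \<open>*\<close> identifies its expression with
    \<open>R\<close>, and \<open>Re\<close> brings the integral back to the reals.\<close>
  define R where "R x = - \<kappa>\<^sup>2 * (cmod (\<psi> x))\<^sup>2 - (w x)\<^sup>2 * (cmod (\<psi> x))\<^sup>2 + 2 * w x * Re (cnj (\<psi> x) * g x)" for x
  have sq: "cnj z * z = complex_of_real ((cmod z)\<^sup>2)" for z
    by (metis complex_norm_square mult.commute of_real_power)
  have re: "cnj z * y + cnj y * z = complex_of_real (2 * Re (cnj y * z))" for y z
    by (simp add: complex_eq_iff)
  have *: "(\<lambda>x. complex_of_real (- \<kappa>\<^sup>2 - (w x)\<^sup>2) * (cnj (\<psi> x) * \<psi> x) +
       complex_of_real (w x) * (cnj (g x) * \<psi> x + cnj (\<psi> x) * g x)) = (\<lambda>x. complex_of_real (R x))"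
    unfolding re sq R_def by (auto simp: fun_eq_iff algebra_simps)
  have AC: "ac_on a b (\<lambda>x. complex_of_real (w x) * (cnj (\<psi> x) * \<psi> x)) (\<lambda>x. complex_of_real (R x))"
    using ac_on_mult[OF W ac_on_mult[OF ac_on_cnj[OF \<psi>] \<psi>]] unfolding * .
  have RC: "(\<lambda>x. complex_of_real (R x)) integrable_on {a..b}"
    using AC unfolding ac_on_def by (blast dest: si)
  have bl: "bounded_linear Re" by (rule bounded_linear_Re)
  have Rint: "R integrable_on {a..b}"
    using integrable_linear[OF RC bl] by (simp add: o_def)
  have Rval: "integral {a..b} R = w b * (cmod (\<psi> b))\<^sup>2 - w a * (cmod (\<psi> a))\<^sup>2"
  proof -
    have "complex_of_real (w b) * (cnj (\<psi> b) * \<psi> b) = complex_of_real (w a) * (cnj (\<psi> a) * \<psi> a)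
       + integral {a..b} (\<lambda>x. complex_of_real (R x))"
      using AC \<open>a \<le> b\<close> unfolding ac_on_def by (meson atLeastAtMost_iff order_refl)
    then have "Re (complex_of_real (w b) * (cnj (\<psi> b) * \<psi> b)) = Re (complex_of_real (w a) * (cnj (\<psi> a) * \<psi> a))
       + Re (integral {a..b} (\<lambda>x. complex_of_real (R x)))" by simp
    then show ?thesis
      unfolding sq integral_linear[OF RC bl, symmetric, unfolded o_def] by (simp add: o_def)
  qed
  have gi: "(\<lambda>x. (cmod (g x))\<^sup>2) integrable_on {a..b}" by (rule si[OF g])
  have pi: "(\<lambda>x. (cmod (\<psi> x))\<^sup>2) integrable_on {a..b}"
    by (intro integrable_continuous_real continuous_intros ac_on_continuous[OF \<psi>])
  have "integral {a..b} R \<le> integral {a..b} (\<lambda>x. (cmod (g x))\<^sup>2 - \<kappa>\<^sup>2 * (cmod (\<psi> x))\<^sup>2)"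
  proof (rule integral_le)
    show "(\<lambda>x. (cmod (g x))\<^sup>2 - \<kappa>\<^sup>2 * (cmod (\<psi> x))\<^sup>2) integrable_on {a..b}"
      using gi pi by (intro integrable_diff integrable_on_mult_right)
    fix x
    have "0 \<le> (cmod (g x - complex_of_real (w x) * \<psi> x))\<^sup>2" by simp
    also have "\<dots> = (cmod (g x))\<^sup>2 + (w x)\<^sup>2 * (cmod (\<psi> x))\<^sup>2 - 2 * w x * Re (cnj (\<psi> x) * g x)"
      unfolding cmod_power2 by (simp add: power2_eq_square algebra_simps)
    finally show "R x \<le> (cmod (g x))\<^sup>2 - \<kappa>\<^sup>2 * (cmod (\<psi> x))\<^sup>2"
      unfolding R_def by simp
  qed fact
  also have "\<dots> = integral {a..b} (\<lambda>x. (cmod (g x))\<^sup>2) - \<kappa>\<^sup>2 * integral {a..b} (\<lambda>x. (cmod (\<psi> x))\<^sup>2)"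
    using gi pi by (simp add: Henstock_Kurzweil_Integration.integral_diff integrable_on_mult_right)
  finally show ?thesis using Rval by simp
qed

section \<open>The form domain\<close>

lemma absolutely_integrable_I2pi:
  fixes f :: "real \<Rightarrow> 'a::euclidean_space"
  shows "set_integrable lebesgue I2pi f \<longleftrightarrow> f absolutely_integrable_on {0..2 * pi}"
proof (rule absolutely_integrable_spike_set_eq)
  show "negligible {x \<in> I2pi - {0..2 * pi}. f x \<noteq> 0}"
    by (rule negligible_subset[of "{}"]) (auto simp: I2pi_def)
  show "negligible {x \<in> {0..2 * pi} - I2pi. f x \<noteq> 0}"
    by (rule negligible_subset[of "{0, 2 * pi}"]) (auto simp: I2pi_def)
qed

lemma integral_I2pi:
  fixes f :: "real \<Rightarrow> 'a::euclidean_space"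
  assumes "f absolutely_integrable_on {0..2 * pi}"
  shows "(LINT x:I2pi|lebesgue. f x) = integral {0..2 * pi} f"
proof -
  have "(LINT x:I2pi|lebesgue. f x) = integral I2pi f"
    using assms by (simp add: set_lebesgue_integral_eq_integral(2) absolutely_integrable_I2pi)
  also have "\<dots> = integral {0..2 * pi} f"
    unfolding I2pi_def by (rule integral_spike_set) (auto intro: negligible_subset[of "{0, 2 * pi}"])
  finally show ?thesis .
qed

text \<open>Square integrability implies integrability because the interval has finite measure;
  passing to the closed interval adds only two points.\<close>

lemma L2I_absolutely_integrable:
  assumes "g \<in> L2I"
  shows "g absolutely_integrable_on {0..2 * pi}"
    and "(\<lambda>x. (cmod (g x))\<^sup>2) absolutely_integrable_on {0..2 * pi}"
proof -
  have m: "g \<in> borel_measurable (lebesgue_on I2pi)"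
    using assms by (simp add: L2I_def set_borel_measurable_def borel_measurable_restrict_space_iff I2pi_def)
  have sq: "set_integrable lebesgue I2pi (\<lambda>x. (cmod (g x))\<^sup>2)"
    using assms by (simp add: L2I_def)
  then show "(\<lambda>x. (cmod (g x))\<^sup>2) absolutely_integrable_on {0..2 * pi}"
    by (simp add: absolutely_integrable_I2pi)
  interpret finite_measure "lebesgue_on I2pi"
    unfolding I2pi_def by (rule finite_measure_lebesgue_on) (auto intro: bounded_set_imp_lmeasurable)
  have "integrable (lebesgue_on I2pi) (\<lambda>x. (cmod (g x))\<^sup>2)"
    using sq by (simp add: integrable_restrict_space set_integrable_def I2pi_def)
  moreover have "(\<lambda>x. cmod (g x)) \<in> borel_measurable (lebesgue_on I2pi)"
    using m by measurable
  ultimately have "integrable (lebesgue_on I2pi) (\<lambda>x. cmod (g x))"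
    by (rule square_integrable_imp_integrable[rotated])
  then have "integrable (lebesgue_on I2pi) g"
    using m integrable_norm_iff by blast
  then have "set_integrable lebesgue I2pi g"
    by (simp add: integrable_restrict_space set_integrable_def I2pi_def)
  then show "g absolutely_integrable_on {0..2 * pi}"
    by (simp add: absolutely_integrable_I2pi)
qed

lemma bounded_measurable_in_L2I:
  assumes "f \<in> borel_measurable (lebesgue_on {0..2 * pi})" "\<And>x. x \<in> {0..2 * pi} \<Longrightarrow> cmod (f x) \<le> B"
  shows "f \<in> L2I"
proof -
  have sub: "I2pi \<subseteq> {0..2 * pi}" by (auto simp: I2pi_def)
  have m: "f \<in> borel_measurable (lebesgue_on I2pi)"
    using measurable_restrict_mono[OF assms(1) sub] .
  then have "set_borel_measurable lebesgue I2pi f"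
    by (simp add: set_borel_measurable_def borel_measurable_restrict_space_iff I2pi_def)
  interpret finite_measure "lebesgue_on I2pi"
    unfolding I2pi_def by (rule finite_measure_lebesgue_on) (auto intro: bounded_set_imp_lmeasurable)
  have "integrable (lebesgue_on I2pi) (\<lambda>x. (cmod (f x))\<^sup>2)"
  proof (rule integrable_const_bound[of _ "B\<^sup>2"])
    show "AE x in lebesgue_on I2pi. norm ((cmod (f x))\<^sup>2) \<le> B\<^sup>2"
      using assms(2) sub by (intro AE_I2) (auto intro!: power_mono)
  qed (use m in auto)
  then have "set_integrable lebesgue I2pi (\<lambda>x. (cmod (f x))\<^sup>2)"
    by (simp add: integrable_restrict_space set_integrable_def I2pi_def)
  then show ?thesis using \<open>set_borel_measurable lebesgue I2pi f\<close> by (simp add: L2I_def)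
qed

lemma weak_deriv_H1I:
  assumes "\<psi> \<in> H1I"
  shows "weak_deriv \<psi> \<in> L2I" and "has_weak_deriv \<psi> (weak_deriv \<psi>)"
  using assms someI_ex[of "\<lambda>g. g \<in> L2I \<and> has_weak_deriv \<psi> g"] unfolding H1I_def weak_deriv_def by auto

text \<open>Members of the domain are arbitrary outside the open interval, and their periodicity
  concerns one-sided limits. The representative \<Psi> is continuous up to both ends, so that 0 and
  2\<pi> become vertices with genuine values, and it keeps the interior values seen by the
  interactions.\<close>

lemma delta_form_dom_ac_on:
  assumes "\<psi> \<in> delta_form_dom"
  obtains \<Psi> where "ac_on 0 (2 * pi) \<Psi> (weak_deriv \<psi>)" "\<Psi> (2 * pi) = \<Psi> 0"
    "\<And>x. x \<in> I2pi \<Longrightarrow> \<Psi> x = \<psi> x"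
proof -
  define g where "g = weak_deriv \<psi>"
  have H: "\<psi> \<in> H1I" using assms by (simp add: delta_form_dom_def)
  obtain c where c: "(\<psi> \<longlongrightarrow> c) (at_right 0)" "(\<psi> \<longlongrightarrow> c) (at_left (2 * pi))"
    using assms by (auto simp: delta_form_dom_def)
  have gi: "g absolutely_integrable_on {0..2 * pi}"
    and wd: "has_weak_deriv \<psi> g"
    using weak_deriv_H1I[OF H] L2I_absolutely_integrable unfolding g_def by auto
  note si = set_lebesgue_integral_eq_integral
  define J where "J x = integral {0..x} g" for x
  have cJ: "continuous_on {0..2 * pi} J"
    unfolding J_def by (intro indefinite_integral_continuous_1 si(1)[OF gi])
  have J0: "J 0 = 0" by (simp add: J_def)
  have diff: "\<psi> b - \<psi> a = J b - J a" if "a \<in> I2pi" "b \<in> I2pi" "a \<le> b" for a b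
  proof -
    have "\<psi> b - \<psi> a = integral {a..b} g"
      using wd that unfolding has_weak_deriv_def by (metis si(2))
    moreover have "integral {0..a} g + integral {a..b} g = integral {0..b} g"
    proof (rule Henstock_Kurzweil_Integration.integral_combine)
      show "g integrable_on {0..b}"
        by (rule si(1), rule absolutely_integrable_on_subinterval[OF gi]) (use that in \<open>auto simp: I2pi_def\<close>)
    qed (use that in \<open>auto simp: I2pi_def\<close>)
    ultimately show ?thesis by (simp add: J_def algebra_simps)
  qed
  have pI: "pi \<in> I2pi" by (simp add: I2pi_def)
  define d where "d = \<psi> pi - J pi"
  have psi: "\<psi> x = d + J x" if "x \<in> I2pi" for x
    using diff[OF that pI] diff[OF pI that] unfolding d_def by (cases "x \<le> pi") (auto simp: algebra_simps)
  have "((\<lambda>x. d + J x) \<longlongrightarrow> d + J 0) (at_right 0)"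
  proof -
    have "(J \<longlongrightarrow> J 0) (at 0 within {0..2 * pi})"
      using cJ by (simp add: continuous_on_def)
    moreover have "at (0::real) within {0..2 * pi} = at_right 0"
      by (rule at_within_Icc_at_right) simp
    ultimately show ?thesis by (intro tendsto_intros) simp
  qed
  moreover have "((\<lambda>x. d + J x) \<longlongrightarrow> c) (at_right 0)"
    by (rule Lim_transform_eventually[OF c(1)], rule eventually_at_rightI[of 0 "2 * pi"])
      (auto simp: psi I2pi_def)
  ultimately have c0: "c = d + J 0"
    using tendsto_unique[OF trivial_limit_at_right_real] by blast
  have "((\<lambda>x. d + J x) \<longlongrightarrow> d + J (2 * pi)) (at_left (2 * pi))"
  proof -
    have "(J \<longlongrightarrow> J (2 * pi)) (at (2 * pi) within {0..2 * pi})"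
      using cJ by (simp add: continuous_on_def)
    moreover have "at (2 * pi) within {0..2 * pi} = at_left (2 * pi)"
      by (rule at_within_Icc_at_left) simp
    ultimately show ?thesis by (intro tendsto_intros) simp
  qed
  moreover have "((\<lambda>x. d + J x) \<longlongrightarrow> c) (at_left (2 * pi))"
    by (rule Lim_transform_eventually[OF c(2)], rule eventually_at_leftI[of 0 "2 * pi"])
      (auto simp: psi I2pi_def)
  ultimately have c1: "c = d + J (2 * pi)"
    using tendsto_unique[OF trivial_limit_at_left_real] by blast
  show thesis
  proof (rule that[of "\<lambda>x. d + J x"])
    show "ac_on 0 (2 * pi) (\<lambda>x. d + J x) (weak_deriv \<psi>)"
      using gi J0 unfolding ac_on_def g_def[symmetric] by (auto simp: J_def)
  qed (use c0 c1 psi in auto)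
qed

lemma ac_on_in_delta_form_dom:
  assumes U: "ac_on 0 (2 * pi) U g" and "g \<in> L2I" and "U (2 * pi) = U 0"
  shows "U \<in> delta_form_dom" and "has_weak_deriv U g"
proof -
  note si = set_lebesgue_integral_eq_integral
  have cU: "continuous_on {0..2 * pi} U" using ac_on_continuous[OF U] .
  then have "bounded (U ` {0..2 * pi})" by (intro compact_imp_bounded compact_continuous_image) auto
  then obtain B where B: "\<And>x. x \<in> {0..2 * pi} \<Longrightarrow> cmod (U x) \<le> B"
    unfolding bounded_iff by blast
  have "U \<in> borel_measurable (lebesgue_on {0..2 * pi})"
    using cU by (intro continuous_imp_measurable_on_sets_lebesgue) auto
  then have UL: "U \<in> L2I" using B by (rule bounded_measurable_in_L2I)
  show wd: "has_weak_deriv U g"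
    unfolding has_weak_deriv_def
  proof (intro ballI impI)
    fix a b assume ab: "a \<in> I2pi" "b \<in> I2pi" "a \<le> b"
    then have "ac_on a b U g" by (intro ac_on_subinterval[OF U]) (auto simp: I2pi_def)
    then have "g absolutely_integrable_on {a..b}" "U b = U a + integral {a..b} g"
      using \<open>a \<le> b\<close> unfolding ac_on_def by (blast, meson atLeastAtMost_iff order_refl)
    then show "set_integrable lebesgue {a..b} g \<and> U b - U a = (LINT x:{a..b}|lebesgue. g x)"
      using si(2)[of "{a..b}" g] by simp
  qed
  have "(U \<longlongrightarrow> U 0) (at 0 within {0..2 * pi})"
    using cU by (simp add: continuous_on_def)
  moreover have "at (0::real) within {0..2 * pi} = at_right 0"
    by (rule at_within_Icc_at_right) simp
  moreover have "(U \<longlongrightarrow> U (2 * pi)) (at (2 * pi) within {0..2 * pi})"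
    using cU by (simp add: continuous_on_def)
  moreover have "at (2 * pi) within {0..2 * pi} = at_left (2 * pi)"
    by (rule at_within_Icc_at_left) simp
  ultimately show "U \<in> delta_form_dom"
    using UL wd assms unfolding delta_form_dom_def H1I_def by auto
qed

section \<open>Vertices on the loop\<close>

text \<open>The loop is cut at 0, which is always a vertex and never carries an interaction;
  periodicity becomes equality of the values at indices \<open>0\<close> and \<open>n\<close>. The
  set \<open>J\<close> selects the vertices that carry an interaction.\<close>

locale mesh =
  fixes n :: nat and p :: "nat \<Rightarrow> real" and J :: "nat set" and \<alpha> :: real
  assumes n_pos: "0 < n" and p_0: "p 0 = 0" and p_n: "p n = 2 * pi"
    and p_less_Suc: "\<And>i. i < n \<Longrightarrow> p i < p (Suc i)"
    and J_subset: "J \<subseteq> {1..<n}"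
begin

lemma p_mono: "i \<le> j \<Longrightarrow> j \<le> n \<Longrightarrow> p i \<le> p j"
proof (induction j rule: dec_induct)
  case (step j)
  then show ?case using p_less_Suc[of j] by simp
qed simp

lemma p_less: "i < j \<Longrightarrow> j \<le> n \<Longrightarrow> p i < p j"
  using p_less_Suc[of i] p_mono[of "Suc i" j] by simp

lemma p_bounds: "i \<le> n \<Longrightarrow> 0 \<le> p i \<and> p i \<le> 2 * pi"
  using p_mono[of 0 i] p_mono[of i n] p_0 p_n by simp

lemma inj_on_p: "inj_on p {..n}"
  by (rule linorder_inj_onI) (use p_less in force)+

lemma finite_J: "finite J"
  using J_subset finite_subset by blast

lemma sum_vertices: "sum f (p ` J) = (\<Sum>i\<in>J. f (p i))"
proof -
  have "inj_on p J" using inj_on_p by (rule inj_on_subset) (use J_subset in auto)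
  then show ?thesis by (simp add: sum.reindex)
qed

lemma p_in_I2pi: "i \<in> J \<Longrightarrow> p i \<in> I2pi"
  using p_less[of 0 i] p_less[of i n] p_0 p_n J_subset by (auto simp: I2pi_def subset_iff)

lemma arc_subset: "i < n \<Longrightarrow> {p i..p (Suc i)} \<subseteq> {0..2 * pi}"
  using p_bounds[of i] p_bounds[of "Suc i"] by auto

lemma integral_arcs:
  fixes f :: "real \<Rightarrow> 'a::euclidean_space"
  assumes "f integrable_on {0..2 * pi}"
  shows "integral {0..2 * pi} f = (\<Sum>i<n. integral {p i..p (Suc i)} f)"
proof -
  have "m \<le> n \<Longrightarrow> integral {0..p m} f = (\<Sum>i<m. integral {p i..p (Suc i)} f)" for m
  proof (induction m)
    case (Suc m)
    have "integral {0..p m} f + integral {p m..p (Suc m)} f = integral {0..p (Suc m)} f"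
    proof (rule Henstock_Kurzweil_Integration.integral_combine)
      show "f integrable_on {0..p (Suc m)}"
        using assms by (rule integrable_on_subinterval) (use p_bounds[OF Suc.prems] in auto)
    qed (use Suc.prems p_bounds p_mono in auto)
    then show ?case using Suc by simp
  qed (simp add: p_0)
  from this[of n] show ?thesis by (simp add: p_n)
qed

text \<open>The Riccati variable may jump at vertices. Summing \<open>riccati_energy\<close> over
  the arcs leaves only its boundary values, and \<open>vertices\<close> demands that the
  interactions compensate the jumps. There \<open>d i\<close> stands for the squared modulus of
  \<psi> at vertex \<open>i\<close>, which makes the condition linear.\<close>

lemma riccati_form_bound:
  assumes \<psi>: "\<psi> \<in> delta_form_dom"
    and w: "\<And>i x. i < n \<Longrightarrow> x \<in> {p i..p (Suc i)} \<Longrightarrow> (w i has_real_derivative - \<kappa>\<^sup>2 - (w i x)\<^sup>2) (at x)"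
    and vertices: "\<And>d. (\<And>i. 0 \<le> d i) \<Longrightarrow> d n = d 0 \<Longrightarrow>
      0 \<le> (\<Sum>i<n. w i (p (Suc i)) * d (Suc i) - w i (p i) * d i) + \<alpha> * (\<Sum>i\<in>J. d i)"
  shows "\<kappa>\<^sup>2 * (LINT x:I2pi|lebesgue. (cmod (\<psi> x))\<^sup>2)
    \<le> (LINT x:I2pi|lebesgue. (cmod (weak_deriv \<psi> x))\<^sup>2) + \<alpha> * (\<Sum>q\<in>p ` J. (cmod (\<psi> q))\<^sup>2)"
proof -
  note si = set_lebesgue_integral_eq_integral
  define g where "g = weak_deriv \<psi>"
  have "\<psi> \<in> H1I" using \<psi> by (simp add: delta_form_dom_def)
  then have gL: "g \<in> L2I" unfolding g_def by (rule weak_deriv_H1I)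
  obtain \<Psi> where \<Psi>: "ac_on 0 (2 * pi) \<Psi> g" "\<Psi> (2 * pi) = \<Psi> 0" "\<And>x. x \<in> I2pi \<Longrightarrow> \<Psi> x = \<psi> x"
    using delta_form_dom_ac_on[OF \<psi>] unfolding g_def by metis
  have g2: "(\<lambda>x. (cmod (g x))\<^sup>2) absolutely_integrable_on {0..2 * pi}"
    by (rule L2I_absolutely_integrable(2)[OF gL])
  have c\<Psi>2: "continuous_on {0..2 * pi} (\<lambda>x. (cmod (\<Psi> x))\<^sup>2)"
    by (intro continuous_intros ac_on_continuous[OF \<Psi>(1)])
  define d where "d i = (cmod (\<Psi> (p i)))\<^sup>2" for i
  have "0 \<le> (\<Sum>i<n. w i (p (Suc i)) * d (Suc i) - w i (p i) * d i) + \<alpha> * (\<Sum>i\<in>J. d i)"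
    by (rule vertices) (auto simp: d_def p_0 p_n \<Psi>(2))
  also have "(\<Sum>i<n. w i (p (Suc i)) * d (Suc i) - w i (p i) * d i)
    \<le> (\<Sum>i<n. integral {p i..p (Suc i)} (\<lambda>x. (cmod (g x))\<^sup>2) - \<kappa>\<^sup>2 * integral {p i..p (Suc i)} (\<lambda>x. (cmod (\<Psi> x))\<^sup>2))"
  proof (rule sum_mono)
    fix i assume "i \<in> {..<n}"
    then have i: "i < n" by simp
    show "w i (p (Suc i)) * d (Suc i) - w i (p i) * d i
      \<le> integral {p i..p (Suc i)} (\<lambda>x. (cmod (g x))\<^sup>2) - \<kappa>\<^sup>2 * integral {p i..p (Suc i)} (\<lambda>x. (cmod (\<Psi> x))\<^sup>2)"
      unfolding d_def
    proof (rule riccati_energy)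
      show "ac_on (p i) (p (Suc i)) \<Psi> g"
        by (rule ac_on_subinterval[OF \<Psi>(1)]) (use arc_subset[OF i] p_less_Suc[OF i] in auto)
      show "(\<lambda>x. (cmod (g x))\<^sup>2) absolutely_integrable_on {p i..p (Suc i)}"
        by (rule absolutely_integrable_on_subinterval[OF g2 arc_subset[OF i]])
    qed (use w[OF i] p_less_Suc[OF i] in auto)
  qed
  also have "\<dots> = integral {0..2 * pi} (\<lambda>x. (cmod (g x))\<^sup>2) - \<kappa>\<^sup>2 * integral {0..2 * pi} (\<lambda>x. (cmod (\<Psi> x))\<^sup>2)"
    unfolding integral_arcs[OF si(1)[OF g2]] integral_arcs[OF integrable_continuous_real[OF c\<Psi>2]]
    by (simp add: sum_subtractf sum_distrib_left)
  also have "integral {0..2 * pi} (\<lambda>x. (cmod (g x))\<^sup>2) = (LINT x:I2pi|lebesgue. (cmod (g x))\<^sup>2)"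
    by (rule integral_I2pi[OF g2, symmetric])
  also have "integral {0..2 * pi} (\<lambda>x. (cmod (\<Psi> x))\<^sup>2) = (LINT x:I2pi|lebesgue. (cmod (\<Psi> x))\<^sup>2)"
    by (rule integral_I2pi[symmetric]) (rule absolutely_integrable_continuous_real[OF c\<Psi>2])
  also have "\<dots> = (LINT x:I2pi|lebesgue. (cmod (\<psi> x))\<^sup>2)"
    by (rule set_lebesgue_integral_cong) (auto simp: \<Psi>(3) I2pi_def)
  also have "(\<Sum>i\<in>J. d i) = (\<Sum>q\<in>p ` J. (cmod (\<psi> q))\<^sup>2)"
    unfolding sum_vertices d_def by (intro sum.cong) (auto simp: \<Psi>(3) p_in_I2pi)
  finally show ?thesis unfolding g_def by simp
qed

text \<open>Testing the eigenvalue equation with the eigenfunction itself turns the form bound into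
  an inequality between multiples of its squared norm, which is nonzero.\<close>

lemma riccati_eigenvalue_bound:
  assumes ev: "is_eigenvalue (delta_operator \<alpha> (p ` J)) (of_real \<mu>)"
    and w: "\<And>i x. i < n \<Longrightarrow> x \<in> {p i..p (Suc i)} \<Longrightarrow> (w i has_real_derivative - \<kappa>\<^sup>2 - (w i x)\<^sup>2) (at x)"
    and vertices: "\<And>d. (\<And>i. 0 \<le> d i) \<Longrightarrow> d n = d 0 \<Longrightarrow>
      0 \<le> (\<Sum>i<n. w i (p (Suc i)) * d (Suc i) - w i (p i) * d i) + \<alpha> * (\<Sum>i\<in>J. d i)"
  shows "\<kappa>\<^sup>2 \<le> \<mu>"
proof -
  obtain \<psi> where \<psi>: "\<psi> \<in> delta_form_dom"
    and eq: "\<And>\<eta>. \<eta> \<in> delta_form_dom \<Longrightarrow> delta_form \<alpha> (p ` J) \<eta> \<psi> = L2I_inner \<eta> (\<lambda>x. of_real \<mu> * \<psi> x)"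
    and nz: "\<not> (AE x in lebesgue. x \<in> I2pi \<longrightarrow> \<psi> x = 0)"
    using ev unfolding is_eigenvalue_def delta_operator_def form_operator_def by auto
  define s where "s = (LINT x:I2pi|lebesgue. (cmod (\<psi> x))\<^sup>2)"
  have \<psi>L: "\<psi> \<in> L2I" using \<psi> by (simp add: delta_form_dom_def H1I_def)
  have sq: "cnj z * (of_real \<mu> * z) = complex_of_real (\<mu> * (cmod z)\<^sup>2)" for z
    by (simp add: complex_eq_iff cmod_power2) (simp add: power2_eq_square algebra_simps)
  have "L2I_inner \<psi> (\<lambda>x. of_real \<mu> * \<psi> x) = of_real (\<mu> * s)"
    unfolding L2I_inner_def sq set_integral_complex_of_real s_def by simp
  then have "(LINT x:I2pi|lebesgue. (cmod (weak_deriv \<psi> x))\<^sup>2) + \<alpha> * (\<Sum>q\<in>p ` J. (cmod (\<psi> q))\<^sup>2) = \<mu> * s"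
    using eq[OF \<psi>] unfolding delta_form_diagonal by (simp only: of_real_eq_iff)
  moreover have "\<kappa>\<^sup>2 * s \<le> (LINT x:I2pi|lebesgue. (cmod (weak_deriv \<psi> x))\<^sup>2) + \<alpha> * (\<Sum>q\<in>p ` J. (cmod (\<psi> q))\<^sup>2)"
    unfolding s_def
  proof (rule riccati_form_bound[where w = w])
    show "(w i has_real_derivative - \<kappa>\<^sup>2 - (w i x)\<^sup>2) (at x)" if "i < n" "x \<in> {p i..p (Suc i)}" for i x
      using that by (rule w)
    show "0 \<le> (\<Sum>i<n. w i (p (Suc i)) * d (Suc i) - w i (p i) * d i) + \<alpha> * (\<Sum>i\<in>J. d i)"
      if "\<And>i. 0 \<le> d i" "d n = d 0" for d
      using that by (rule vertices)
  qed fact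
  ultimately have le: "\<kappa>\<^sup>2 * s \<le> \<mu> * s" by simp
  have int: "integrable lebesgue (\<lambda>x. indicator I2pi x *\<^sub>R (cmod (\<psi> x))\<^sup>2)"
    using \<psi>L by (simp add: L2I_def set_integrable_def)
  have "0 \<le> s" unfolding s_def set_lebesgue_integral_def by (rule integral_nonneg_AE) auto
  moreover have "s \<noteq> 0"
  proof
    assume "s = 0"
    then have "AE x in lebesgue. indicator I2pi x *\<^sub>R (cmod (\<psi> x))\<^sup>2 = 0"
      using integral_nonneg_eq_0_iff_AE[OF int] unfolding s_def set_lebesgue_integral_def by auto
    then have "AE x in lebesgue. x \<in> I2pi \<longrightarrow> \<psi> x = 0"
      by eventually_elim auto
    then show False using nz by simp
  qed
  ultimately show ?thesis using le by simp
qed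

end

text \<open>The value at \<kappa> = 0 is the limit. It allows the vertex form to be followed
  continuously from \<kappa> = 0, where it is the energy of piecewise linear functions and
  definiteness is easy.\<close>

definition sinhat :: "real \<Rightarrow> real \<Rightarrow> real"
  where "sinhat \<kappa> h = (if \<kappa> = 0 then h else sin (\<kappa> * h) / \<kappa>)"

lemma sinhat_pos: "0 \<le> \<kappa> \<Longrightarrow> 0 < h \<Longrightarrow> \<kappa> * h < pi \<Longrightarrow> 0 < sinhat \<kappa> h"
  by (auto simp: sinhat_def intro!: divide_pos_pos sin_gt_zero)

section \<open>Trigonometric interpolation between vertices\<close>

context mesh
begin

definition gap :: "nat \<Rightarrow> real"
  where "gap i = p (Suc i) - p i"

text \<open>
  The diagonal \<open>vform \<kappa> c c\<close> is \<open>q(u) - \<kappa>\<^sup>2 \<parallel>u\<parallel>\<^sup>2\<close> for the function \<open>u\<close> with vertex values \<open>c\<close>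
  that solves \<open>- u'' = \<kappa>\<^sup>2 u\<close> between the vertices. Sequences represent functions on the cycle of
  vertices when \<open>c n = c 0\<close>.
\<close>

definition vform :: "real \<Rightarrow> (nat \<Rightarrow> real) \<Rightarrow> (nat \<Rightarrow> real) \<Rightarrow> real"
  where "vform \<kappa> c d =
    (\<Sum>i<n. ((c i * d i + c (Suc i) * d (Suc i)) * cos (\<kappa> * gap i) - c i * d (Suc i) - c (Suc i) * d i)
       / sinhat \<kappa> (gap i)) + \<alpha> * (\<Sum>i\<in>J. c i * d i)"

lemma gap_pos: "i < n \<Longrightarrow> 0 < gap i"
  using p_less_Suc by (simp add: gap_def)

text \<open>The solution of \<open>- u'' = \<kappa>\<^sup>2 u\<close> on arc \<open>i\<close> with
  end values \<open>c i\<close> and \<open>c (Suc i)\<close>, provided that 0 < \<kappa> and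
  \<kappa> times the arc length is below \<pi>.\<close>

definition trig_arc :: "real \<Rightarrow> (nat \<Rightarrow> real) \<Rightarrow> nat \<Rightarrow> real \<Rightarrow> real"
  where "trig_arc \<kappa> c i x =
    (c i * sin (\<kappa> * (p (Suc i) - x)) + c (Suc i) * sin (\<kappa> * (x - p i))) / sin (\<kappa> * gap i)"

definition trig_arc' :: "real \<Rightarrow> (nat \<Rightarrow> real) \<Rightarrow> nat \<Rightarrow> real \<Rightarrow> real"
  where "trig_arc' \<kappa> c i x =
    \<kappa> * (c (Suc i) * cos (\<kappa> * (x - p i)) - c i * cos (\<kappa> * (p (Suc i) - x))) / sin (\<kappa> * gap i)"

lemma DERIV_trig_arc: "(trig_arc \<kappa> c i has_real_derivative trig_arc' \<kappa> c i x) (at x)"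
  unfolding trig_arc_def trig_arc'_def divide_inverse
  by (rule derivative_eq_intros | simp)+ (simp add: algebra_simps)

lemma DERIV_trig_arc': "(trig_arc' \<kappa> c i has_real_derivative - \<kappa>\<^sup>2 * trig_arc \<kappa> c i x) (at x)"
  unfolding trig_arc_def trig_arc'_def divide_inverse
  by (rule derivative_eq_intros | simp)+ (simp add: algebra_simps power2_eq_square)

text \<open>The last part is the origin of the summands of \<open>vform\<close>: they are the
  boundary terms left by integration by parts on one arc against a function with end values
  \<open>x\<close> and \<open>y\<close>.\<close>

lemma trig_arc_boundary:
  assumes "0 < \<kappa>" "i < n" "\<kappa> * gap i < pi"
  shows "trig_arc \<kappa> c i (p i) = c i" and "trig_arc \<kappa> c i (p (Suc i)) = c (Suc i)"
    and "trig_arc' \<kappa> c i (p (Suc i)) * y - trig_arc' \<kappa> c i (p i) * x =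
      ((c i * x + c (Suc i) * y) * cos (\<kappa> * gap i) - c i * y - c (Suc i) * x) / sinhat \<kappa> (gap i)"
proof -
  have "0 < sin (\<kappa> * gap i)" using assms gap_pos by (intro sin_gt_zero) auto
  then show "trig_arc \<kappa> c i (p i) = c i" "trig_arc \<kappa> c i (p (Suc i)) = c (Suc i)"
    "trig_arc' \<kappa> c i (p (Suc i)) * y - trig_arc' \<kappa> c i (p i) * x =
      ((c i * x + c (Suc i) * y) * cos (\<kappa> * gap i) - c i * y - c (Suc i) * x) / sinhat \<kappa> (gap i)"
    using assms(1) by (auto simp: trig_arc_def trig_arc'_def sinhat_def gap_def field_simps)
qed

text \<open>Both sines are nonnegative on the arc because \<kappa> times its length is below \<pi>,
  and they never vanish at the same point.\<close>

lemma trig_arc_pos: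
  assumes \<kappa>: "0 < \<kappa>" and i: "i < n" "\<kappa> * gap i < pi" and c: "0 < c i" "0 < c (Suc i)" and x: "x \<in> {p i..p (Suc i)}"
  shows "0 < trig_arc \<kappa> c i x"
proof -
  have s: "0 < sin (\<kappa> * gap i)" using \<kappa> i gap_pos by (intro sin_gt_zero) auto
  have nonneg: "0 \<le> sin (\<kappa> * t)" if "0 \<le> t" "t \<le> gap i" for t
  proof (rule sin_ge_zero)
    show "\<kappa> * t \<le> pi" using mult_left_mono[OF that(2), of \<kappa>] i \<kappa> by linarith
  qed (use that \<kappa> in auto)
  have pos: "0 < sin (\<kappa> * t)" if "0 < t" "t \<le> gap i" for t
  proof (rule sin_gt_zero)
    show "\<kappa> * t < pi" using mult_left_mono[OF that(2), of \<kappa>] i \<kappa> by linarith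
  qed (use that \<kappa> in auto)
  have "0 < c i * sin (\<kappa> * (p (Suc i) - x)) + c (Suc i) * sin (\<kappa> * (x - p i))"
  proof (cases "x = p i")
    case True
    then show ?thesis using pos[of "gap i"] gap_pos[OF i(1)] c by (simp add: gap_def)
  next
    case False
    then have "0 < sin (\<kappa> * (x - p i))" "0 \<le> sin (\<kappa> * (p (Suc i) - x))"
      using x by (auto intro!: pos nonneg simp: gap_def)
    then show ?thesis using c by (intro add_nonneg_pos) auto
  qed
  then show ?thesis using s by (simp add: trig_arc_def)
qed

text \<open>Half-open arcs make the sum pick exactly one summand at each point below 2\<pi>; the
  right end of an arc is then a null set to be ignored in integrals.\<close>

definition trig_spline' :: "real \<Rightarrow> (nat \<Rightarrow> real) \<Rightarrow> real \<Rightarrow> complex"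
  where "trig_spline' \<kappa> c x = (\<Sum>i<n. indicator {p i..<p (Suc i)} x * complex_of_real (trig_arc' \<kappa> c i x))"

text \<open>Defined as a primitive, so that absolute continuity is immediate for all \<kappa> and
  \<open>c\<close>; agreement with the arcs is what remains to be shown.\<close>

definition trig_spline :: "real \<Rightarrow> (nat \<Rightarrow> real) \<Rightarrow> real \<Rightarrow> complex"
  where "trig_spline \<kappa> c x = of_real (c 0) + integral {0..x} (trig_spline' \<kappa> c)"

lemma trig_spline'_eq:
  assumes "i < n" "x \<in> {p i..<p (Suc i)}"
  shows "trig_spline' \<kappa> c x = of_real (trig_arc' \<kappa> c i x)"
proof -
  have "trig_spline' \<kappa> c x = (\<Sum>j<n. if j = i then complex_of_real (trig_arc' \<kappa> c i x) else 0)"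
    unfolding trig_spline'_def
  proof (rule sum.cong)
    fix j assume j: "j \<in> {..<n}"
    have "x \<notin> {p j..<p (Suc j)}" if "j \<noteq> i"
      using that assms j p_mono[of "Suc j" i] p_mono[of "Suc i" j] by (cases j i rule: linorder_cases) auto
    then show "indicator {p j..<p (Suc j)} x * complex_of_real (trig_arc' \<kappa> c j x) =
        (if j = i then complex_of_real (trig_arc' \<kappa> c i x) else 0)"
      using assms by auto
  qed simp
  then show ?thesis using assms by simp
qed

lemma continuous_on_trig_arc: "continuous_on S (trig_arc \<kappa> c i)" "continuous_on S (trig_arc' \<kappa> c i)"
  by (intro continuous_at_imp_continuous_on ballI, rule DERIV_isCont, rule DERIV_trig_arc DERIV_trig_arc')+

lemma trig_spline'_L2I: "trig_spline' \<kappa> c \<in> L2I" and trig_spline'_measurable: "trig_spline' \<kappa> c \<in> borel_measurable (lebesgue_on {0..2 * pi})"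
  and trig_spline'_bounded: "bounded (trig_spline' \<kappa> c ` {0..2 * pi})"
proof -
  have [measurable]: "trig_arc' \<kappa> c i \<in> borel_measurable borel" for i
    by (intro borel_measurable_continuous_onI continuous_on_trig_arc)
  have "trig_spline' \<kappa> c \<in> borel_measurable borel"
    unfolding trig_spline'_def by measurable
  then show m: "trig_spline' \<kappa> c \<in> borel_measurable (lebesgue_on {0..2 * pi})"
    by (intro measurable_restrict_space1 measurable_completion) simp
  define B where "B = (\<Sum>i<n. \<bar>\<kappa>\<bar> * (\<bar>c (Suc i)\<bar> + \<bar>c i\<bar>) / \<bar>sin (\<kappa> * gap i)\<bar>)"
  have B: "cmod (trig_spline' \<kappa> c x) \<le> B" for x
    unfolding trig_spline'_def B_def
  proof (rule sum_norm_le)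
    fix i
    have "\<bar>c (Suc i) * cos (\<kappa> * (x - p i)) - c i * cos (\<kappa> * (p (Suc i) - x))\<bar> \<le> \<bar>c (Suc i)\<bar> + \<bar>c i\<bar>"
      by (rule order_trans[OF abs_triangle_ineq4]) (auto simp: abs_mult intro!: add_mono mult_left_le)
    then have "\<bar>trig_arc' \<kappa> c i x\<bar> \<le> \<bar>\<kappa>\<bar> * (\<bar>c (Suc i)\<bar> + \<bar>c i\<bar>) / \<bar>sin (\<kappa> * gap i)\<bar>"
      unfolding trig_arc'_def abs_divide abs_mult by (intro divide_right_mono mult_left_mono) auto
    then show "cmod (indicator {p i..<p (Suc i)} x * complex_of_real (trig_arc' \<kappa> c i x))
      \<le> \<bar>\<kappa>\<bar> * (\<bar>c (Suc i)\<bar> + \<bar>c i\<bar>) / \<bar>sin (\<kappa> * gap i)\<bar>"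
      by (auto simp: indicator_def norm_mult)
  qed
  show "trig_spline' \<kappa> c \<in> L2I"
    using m B by (rule bounded_measurable_in_L2I)
  show "bounded (trig_spline' \<kappa> c ` {0..2 * pi})" using B by (auto simp: bounded_iff)
qed

lemma ac_on_trig_spline: "ac_on 0 (2 * pi) (trig_spline \<kappa> c) (trig_spline' \<kappa> c)"
  using L2I_absolutely_integrable(1)[OF trig_spline'_L2I] by (auto simp: ac_on_def trig_spline_def)

lemma ac_on_of_real:
  assumes "\<And>x. (f has_real_derivative f' x) (at x)" and "continuous_on {a..b} f'"
  shows "ac_on a b (\<lambda>x. of_real (f x)) (\<lambda>x. of_real (f' x))"
proof (rule ac_on_C1)
  show "((\<lambda>x. complex_of_real (f x)) has_vector_derivative complex_of_real (f' x)) (at x within {a..b})" for x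
    by (rule has_vector_derivative_of_real) (rule has_field_derivative_at_within, rule assms(1))
qed (intro continuous_intros assms(2))

lemma ac_on_trig_arc: "ac_on a b (\<lambda>x. of_real (trig_arc \<kappa> c i x)) (\<lambda>x. of_real (trig_arc' \<kappa> c i x))"
  by (rule ac_on_of_real) (rule DERIV_trig_arc continuous_on_trig_arc)+

lemma ac_on_trig_arc': "ac_on a b (\<lambda>x. of_real (trig_arc' \<kappa> c i x)) (\<lambda>x. of_real (- \<kappa>\<^sup>2 * trig_arc \<kappa> c i x))"
  by (rule ac_on_of_real) (rule DERIV_trig_arc' | intro continuous_intros continuous_on_trig_arc)+

text \<open>Agreement propagates along the loop: the correct value at the left vertex gives the
  correct function on the arc, hence the correct value at the next vertex.\<close>

lemma trig_spline_eq:
  assumes \<kappa>: "0 < \<kappa>" "\<And>i. i < n \<Longrightarrow> \<kappa> * gap i < pi"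
    and "i < n" "x \<in> {p i..p (Suc i)}"
  shows "trig_spline \<kappa> c x = of_real (trig_arc \<kappa> c i x)"
proof -
  have step: "trig_spline \<kappa> c x = of_real (trig_arc \<kappa> c i x)"
    if i: "i < n" and x: "x \<in> {p i..p (Suc i)}" and start: "trig_spline \<kappa> c (p i) = of_real (c i)" for i x
  proof -
    have "ac_on (p i) x (trig_spline \<kappa> c) (trig_spline' \<kappa> c)"
      by (rule ac_on_subinterval[OF ac_on_trig_spline]) (use x arc_subset[OF i] in auto)
    then have "trig_spline \<kappa> c x = trig_spline \<kappa> c (p i) + integral {p i..x} (trig_spline' \<kappa> c)"
      using x unfolding ac_on_def by (meson atLeastAtMost_iff order_refl)
    also have "integral {p i..x} (trig_spline' \<kappa> c) = integral {p i..x} (\<lambda>x. of_real (trig_arc' \<kappa> c i x))"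
      by (rule integral_spike[of "{p (Suc i)}"]) (use x in \<open>auto simp: trig_spline'_eq[OF i]\<close>)
    also have "trig_spline \<kappa> c (p i) + \<dots> = of_real (trig_arc \<kappa> c i x)"
      using ac_on_trig_arc[of "p i" x \<kappa> c i] x start trig_arc_boundary(1)[OF \<kappa>(1) i \<kappa>(2)[OF i], of c]
      unfolding ac_on_def by (metis atLeastAtMost_iff order_refl)
    finally show ?thesis .
  qed
  have start: "i \<le> n \<Longrightarrow> trig_spline \<kappa> c (p i) = of_real (c i)" for i
  proof (induction i)
    case (Suc i)
    then have i: "i < n" by simp
    show ?case
      using step[OF i, of "p (Suc i)"] Suc trig_arc_boundary(2)[OF \<kappa>(1) i \<kappa>(2)[OF i], of c] p_less_Suc[OF i] by simp
  qed (simp add: trig_spline_def p_0)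
  show ?thesis using step[OF assms(3,4) start] assms(3) by simp
qed

lemma trig_spline_vertex:
  assumes \<kappa>: "0 < \<kappa>" "\<And>i. i < n \<Longrightarrow> \<kappa> * gap i < pi" and "i \<le> n"
  shows "trig_spline \<kappa> c (p i) = of_real (c i)"
proof (cases i)
  case (Suc j)
  then have j: "j < n" using assms by simp
  show ?thesis
    using trig_spline_eq[OF \<kappa> j, of "p (Suc j)" c] trig_arc_boundary(2)[OF \<kappa>(1) j \<kappa>(2)[OF j], of c] p_less_Suc[OF j] Suc by simp
qed (simp add: trig_spline_def p_0)

text \<open>Integration by parts on each arc yields the inner product on the right plus boundary
  terms. Together with the interactions these form \<open>vform \<kappa> c\<close> evaluated at the
  conjugated vertex values of \<eta>, which \<open>crit\<close> annihilates. Criticality at the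
  vertices is thus the jump condition in weak form.\<close>

lemma delta_form_trig_spline:
  assumes \<kappa>: "0 < \<kappa>" "\<And>i. i < n \<Longrightarrow> \<kappa> * gap i < pi" and c: "c n = c 0"
    and crit: "\<And>d. d n = d 0 \<Longrightarrow> vform \<kappa> c d = 0" and \<eta>: "\<eta> \<in> delta_form_dom"
  shows "delta_form \<alpha> (p ` J) \<eta> (trig_spline \<kappa> c) = L2I_inner \<eta> (\<lambda>x. of_real (\<kappa>\<^sup>2) * trig_spline \<kappa> c x)"
proof -
  note si = set_lebesgue_integral_eq_integral
  let ?U = "trig_spline \<kappa> c" and ?V = "trig_spline' \<kappa> c"
  define g where "g = weak_deriv \<eta>"
  have "\<eta> \<in> H1I" using \<eta> by (simp add: delta_form_dom_def)
  then have gL: "g \<in> L2I" unfolding g_def by (rule weak_deriv_H1I)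
  obtain H where H: "ac_on 0 (2 * pi) H g" "H (2 * pi) = H 0" "\<And>x. x \<in> I2pi \<Longrightarrow> H x = \<eta> x"
    using delta_form_dom_ac_on[OF \<eta>] unfolding g_def by metis
  have per: "?U (2 * pi) = ?U 0"
    using trig_spline_vertex[OF \<kappa>, of 0 c] trig_spline_vertex[OF \<kappa>, of n c] c by (simp add: p_0 p_n)
  have Ud: "?U \<in> delta_form_dom" and Uw: "has_weak_deriv ?U ?V"
    using ac_on_in_delta_form_dom[OF ac_on_trig_spline trig_spline'_L2I per] by auto
  then have UH: "?U \<in> H1I" by (simp add: delta_form_dom_def)
  define D where "D i = cnj (H (p i))" for i
  have cg: "(\<lambda>x. cnj (g x)) absolutely_integrable_on {0..2 * pi}"
    using ac_on_cnj[OF H(1)] by (simp add: ac_on_def)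
  have gV: "(\<lambda>x. ?V x * cnj (g x)) absolutely_integrable_on {0..2 * pi}"
    by (rule absolutely_integrable_bounded_measurable_product[OF bilinear_times _ _ trig_spline'_bounded cg])
       (use trig_spline'_measurable in auto)
  have HU: "continuous_on {0..2 * pi} (\<lambda>x. cnj (H x) * ?U x)"
    by (intro continuous_intros ac_on_continuous[OF H(1)] ac_on_continuous[OF ac_on_trig_spline])
  \<comment> \<open>\<open>weak_deriv\<close> is an arbitrary choice, so it can be exchanged for the
    explicit derivative only almost everywhere.\<close>
  have "L2I_inner g (weak_deriv ?U) = (LINT x:I2pi|lebesgue. ?V x * cnj (g x))"
    unfolding L2I_inner_def set_lebesgue_integral_def
  proof (rule integral_cong_AE)
    have sm: "(\<lambda>x. indicator I2pi x *\<^sub>R f x) \<in> borel_measurable lebesgue" if "f \<in> L2I" for f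
      using that by (simp add: L2I_def set_borel_measurable_def)
    have *: "indicator I2pi x *\<^sub>R (cnj (g x) * h x) = cnj (indicator I2pi x *\<^sub>R g x) * (indicator I2pi x *\<^sub>R h x)" for x h
      by (auto simp: indicator_def)
    have m: "(\<lambda>x. indicator I2pi x *\<^sub>R (cnj (g x) * h x)) \<in> borel_measurable lebesgue" if "h \<in> L2I" for h
      unfolding * by (intro borel_measurable_times sm that measurable_compose[OF sm[OF gL]]
        borel_measurable_continuous_onI continuous_intros)
    show "(\<lambda>x. indicator I2pi x *\<^sub>R (cnj (g x) * weak_deriv ?U x)) \<in> borel_measurable lebesgue"
      by (rule m) (rule weak_deriv_H1I[OF UH])
    show "(\<lambda>x. indicator I2pi x *\<^sub>R (?V x * cnj (g x))) \<in> borel_measurable lebesgue"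
      using m[OF trig_spline'_L2I] by (simp add: mult.commute)
    show "AE x in lebesgue. indicator I2pi x *\<^sub>R (cnj (g x) * weak_deriv ?U x) = indicator I2pi x *\<^sub>R (?V x * cnj (g x))"
      using has_weak_deriv_unique[OF weak_deriv_H1I(2)[OF UH] Uw]
      by eventually_elim (auto simp: indicator_def)
  qed
  also have "\<dots> = (\<Sum>i<n. integral {p i..p (Suc i)} (\<lambda>x. ?V x * cnj (g x)))"
    using integral_I2pi[OF gV] integral_arcs[OF si(1)[OF gV]] by simp
  also have "\<dots> = (\<Sum>i<n. (of_real (trig_arc' \<kappa> c i (p (Suc i))) * D (Suc i) - of_real (trig_arc' \<kappa> c i (p i)) * D i)
      + of_real (\<kappa>\<^sup>2) * integral {p i..p (Suc i)} (\<lambda>x. cnj (H x) * ?U x))"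
  proof (rule sum.cong[OF refl])
    fix i assume "i \<in> {..<n}"
    then have i: "i < n" by simp
    have le: "p i \<le> p (Suc i)" using p_less_Suc[OF i] by simp
    have sub: "{p i..p (Suc i)} \<subseteq> {0..2 * pi}" by (rule arc_subset[OF i])
    have Hi: "ac_on (p i) (p (Suc i)) (\<lambda>x. cnj (H x)) (\<lambda>x. cnj (g x))"
      by (rule ac_on_subinterval[OF ac_on_cnj[OF H(1)]]) (use sub le in auto)
    let ?a = "\<lambda>x. complex_of_real (trig_arc' \<kappa> c i x)"
    have "ac_on (p i) (p (Suc i)) (\<lambda>x. ?a x * cnj (H x))
       (\<lambda>x. of_real (- \<kappa>\<^sup>2 * trig_arc \<kappa> c i x) * cnj (H x) + ?a x * cnj (g x))"
      by (rule ac_on_mult[OF ac_on_trig_arc' Hi])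
    then have parts: "?a (p (Suc i)) * D (Suc i) = ?a (p i) * D i
      + integral {p i..p (Suc i)} (\<lambda>x. of_real (- \<kappa>\<^sup>2 * trig_arc \<kappa> c i x) * cnj (H x) + ?a x * cnj (g x))"
      using le unfolding ac_on_def D_def by (meson atLeastAtMost_iff order_refl)
    have i1: "(\<lambda>x. of_real (- \<kappa>\<^sup>2 * trig_arc \<kappa> c i x) * cnj (H x)) integrable_on {p i..p (Suc i)}"
      by (intro integrable_continuous_real continuous_intros continuous_on_trig_arc ac_on_continuous[OF Hi])
    have i2: "(\<lambda>x. ?a x * cnj (g x)) integrable_on {p i..p (Suc i)}"
      by (rule si(1), rule absolutely_integrable_continuous_mult)
         (use Hi in \<open>auto simp: ac_on_def intro!: continuous_intros continuous_on_trig_arc\<close>)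
    have e1: "integral {p i..p (Suc i)} (\<lambda>x. of_real (- \<kappa>\<^sup>2 * trig_arc \<kappa> c i x) * cnj (H x))
       = - of_real (\<kappa>\<^sup>2) * integral {p i..p (Suc i)} (\<lambda>x. cnj (H x) * ?U x)"
    proof -
      have "integral {p i..p (Suc i)} (\<lambda>x. of_real (- \<kappa>\<^sup>2 * trig_arc \<kappa> c i x) * cnj (H x))
        = integral {p i..p (Suc i)} (\<lambda>x. - of_real (\<kappa>\<^sup>2) * (cnj (H x) * ?U x))"
        by (rule integral_cong) (simp add: trig_spline_eq[OF \<kappa> i] mult.commute mult.left_commute)
      then show ?thesis by simp
    qed
    have e2: "integral {p i..p (Suc i)} (\<lambda>x. ?a x * cnj (g x)) = integral {p i..p (Suc i)} (\<lambda>x. ?V x * cnj (g x))"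
      by (rule integral_spike[of "{p (Suc i)}"]) (auto simp: trig_spline'_eq[OF i])
    show "integral {p i..p (Suc i)} (\<lambda>x. ?V x * cnj (g x)) =
      (?a (p (Suc i)) * D (Suc i) - ?a (p i) * D i)
      + of_real (\<kappa>\<^sup>2) * integral {p i..p (Suc i)} (\<lambda>x. cnj (H x) * ?U x)"
      using parts unfolding Henstock_Kurzweil_Integration.integral_add[OF i1 i2] e1 e2
      by (simp add: algebra_simps)
  qed
  also have "\<dots> = (\<Sum>i<n. of_real (trig_arc' \<kappa> c i (p (Suc i))) * D (Suc i) - of_real (trig_arc' \<kappa> c i (p i)) * D i)
      + of_real (\<kappa>\<^sup>2) * integral {0..2 * pi} (\<lambda>x. cnj (H x) * ?U x)"
    unfolding integral_arcs[OF integrable_continuous_real[OF HU]]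
    by (simp add: sum.distrib sum_distrib_left)
  also have "integral {0..2 * pi} (\<lambda>x. cnj (H x) * ?U x) = L2I_inner \<eta> ?U"
    unfolding L2I_inner_def integral_I2pi[OF absolutely_integrable_continuous_real[OF HU], symmetric]
    by (rule set_lebesgue_integral_cong) (auto simp: H(3) I2pi_def)
  finally have main: "L2I_inner g (weak_deriv ?U) =
     (\<Sum>i<n. of_real (trig_arc' \<kappa> c i (p (Suc i))) * D (Suc i) - of_real (trig_arc' \<kappa> c i (p i)) * D i)
      + of_real (\<kappa>\<^sup>2) * L2I_inner \<eta> ?U" .
  have pts: "(\<Sum>q\<in>p ` J. cnj (\<eta> q) * ?U q) = (\<Sum>i\<in>J. of_real (c i) * D i)"
    unfolding sum_vertices D_def
  proof (rule sum.cong[OF refl])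
    fix i assume i: "i \<in> J"
    then have "i \<le> n" using J_subset by auto
    then show "cnj (\<eta> (p i)) * ?U (p i) = of_real (c i) * cnj (H (p i))"
      using trig_spline_vertex[OF \<kappa>, of i c] H(3)[OF p_in_I2pi[OF i]] by (simp add: mult.commute)
  qed
  have real0: "(\<Sum>i<n. trig_arc' \<kappa> c i (p (Suc i)) * d (Suc i) - trig_arc' \<kappa> c i (p i) * d i) + \<alpha> * (\<Sum>i\<in>J. c i * d i) = 0"
    if "d n = d 0" for d
  proof -
    have "(\<Sum>i<n. trig_arc' \<kappa> c i (p (Suc i)) * d (Suc i) - trig_arc' \<kappa> c i (p i) * d i) + \<alpha> * (\<Sum>i\<in>J. c i * d i) = vform \<kappa> c d"
      unfolding vform_def by (intro arg_cong2[of _ _ _ _ "(+)"] sum.cong) (auto simp: trig_arc_boundary(3) \<kappa>)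
    then show ?thesis using crit[OF that] by simp
  qed
  have Dper: "D n = D 0" using H(2) by (simp add: D_def p_0 p_n)
  \<comment> \<open>Criticality concerns real sequences; it is applied to real and imaginary parts
    separately.\<close>
  have "(\<Sum>i<n. of_real (trig_arc' \<kappa> c i (p (Suc i))) * D (Suc i) - of_real (trig_arc' \<kappa> c i (p i)) * D i)
      + of_real \<alpha> * (\<Sum>i\<in>J. of_real (c i) * D i) = 0"
    using real0[of "\<lambda>i. Re (D i)"] real0[of "\<lambda>i. Im (D i)"] Dper
    by (simp add: complex_eq_iff)
  then have "delta_form \<alpha> (p ` J) \<eta> ?U = of_real (\<kappa>\<^sup>2) * L2I_inner \<eta> ?U"
    unfolding delta_form_def g_def[symmetric] main pts by (simp add: algebra_simps)
  also have "\<dots> = L2I_inner \<eta> (\<lambda>x. of_real (\<kappa>\<^sup>2) * ?U x)"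
    unfolding L2I_inner_def by (subst set_integral_mult_right[symmetric]) (simp add: mult.left_commute)
  finally show ?thesis .
qed

text \<open>Positive vertex values make the spline positive on every closed arc, so its logarithmic
  derivative is defined throughout and solves the Riccati equation there.\<close>

lemma least_eigenvalue:
  assumes \<kappa>: "0 < \<kappa>" "\<And>i. i < n \<Longrightarrow> \<kappa> * gap i < pi" and c: "c n = c 0" "\<And>i. i \<le> n \<Longrightarrow> 0 < c i"
    and crit: "\<And>d. d n = d 0 \<Longrightarrow> vform \<kappa> c d = 0"
  shows "is_eigenvalue (delta_operator \<alpha> (p ` J)) (of_real (\<kappa>\<^sup>2))"
    and "is_eigenvalue (delta_operator \<alpha> (p ` J)) (of_real \<mu>) \<Longrightarrow> \<kappa>\<^sup>2 \<le> \<mu>"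
proof -
  let ?U = "trig_spline \<kappa> c"
  have per: "?U (2 * pi) = ?U 0"
    using trig_spline_vertex[OF \<kappa>, of 0 c] trig_spline_vertex[OF \<kappa>, of n c] c by (simp add: p_0 p_n)
  have Ud: "?U \<in> delta_form_dom"
    using ac_on_in_delta_form_dom[OF ac_on_trig_spline trig_spline'_L2I per] by auto
  then have UL: "?U \<in> L2I" by (simp add: delta_form_dom_def H1I_def)
  have UL': "(\<lambda>x. of_real (\<kappa>\<^sup>2) * ?U x) \<in> L2I"
  proof -
    have cU: "continuous_on {0..2 * pi} (\<lambda>x. of_real (\<kappa>\<^sup>2) * ?U x)"
      by (intro continuous_intros ac_on_continuous[OF ac_on_trig_spline])
    then have "bounded ((\<lambda>x. of_real (\<kappa>\<^sup>2) * ?U x) ` {0..2 * pi})"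
      by (intro compact_imp_bounded compact_continuous_image) auto
    then obtain B where "\<And>x. x \<in> {0..2 * pi} \<Longrightarrow> cmod (of_real (\<kappa>\<^sup>2) * ?U x) \<le> B"
      unfolding bounded_iff by blast
    then show ?thesis
      using cU by (intro bounded_measurable_in_L2I continuous_imp_measurable_on_sets_lebesgue) auto
  qed
  have pos: "0 < trig_arc \<kappa> c i x" if "i < n" "x \<in> {p i..p (Suc i)}" for i x
    using that by (intro trig_arc_pos \<kappa> c) auto
  have nz: "\<not> (AE x in lebesgue. x \<in> I2pi \<longrightarrow> ?U x = 0)"
  proof
    assume "AE x in lebesgue. x \<in> I2pi \<longrightarrow> ?U x = 0"
    then have "AE x in lebesgue. x \<notin> {p 0<..<p (Suc 0)}"
    proof eventually_elim
      case (elim x)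
      have "?U x \<noteq> 0" if x: "x \<in> {p 0<..<p (Suc 0)}"
        using trig_spline_eq[OF \<kappa> n_pos, of x c] pos[OF n_pos, of x] x by auto
      moreover have "x \<in> I2pi" if x: "x \<in> {p 0<..<p (Suc 0)}"
        using x arc_subset[OF n_pos] p_bounds[of "Suc 0"] n_pos by (auto simp: I2pi_def p_0)
      ultimately show ?case using elim by blast
    qed
    then have "{p 0<..<p (Suc 0)} \<in> null_sets lebesgue"
      using AE_iff_null_sets[of "{p 0<..<p (Suc 0)}" lebesgue] by simp
    then show False
      using p_less_Suc[OF n_pos] negligible_iff_null_sets negligible_interval(2)[of "p 0" "p (Suc 0)"] by auto
  qed
  have "(?U, \<lambda>x. of_real (\<kappa>\<^sup>2) * ?U x) \<in> delta_operator \<alpha> (p ` J)"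
    unfolding delta_operator_def form_operator_def
    using Ud UL' delta_form_trig_spline[OF \<kappa> c(1) crit] by auto
  then show "is_eigenvalue (delta_operator \<alpha> (p ` J)) (of_real (\<kappa>\<^sup>2))"
    using nz unfolding is_eigenvalue_def by blast
  assume ev: "is_eigenvalue (delta_operator \<alpha> (p ` J)) (of_real \<mu>)"
  show "\<kappa>\<^sup>2 \<le> \<mu>"
  proof (rule riccati_eigenvalue_bound[OF ev, where w = "\<lambda>i x. trig_arc' \<kappa> c i x / trig_arc \<kappa> c i x"])
    fix i x assume i: "i < n" and x: "x \<in> {p i..p (Suc i)}"
    have "trig_arc \<kappa> c i x \<noteq> 0" using pos[OF i x] by simp
    then show "((\<lambda>x. trig_arc' \<kappa> c i x / trig_arc \<kappa> c i x) has_real_derivative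
        - \<kappa>\<^sup>2 - (trig_arc' \<kappa> c i x / trig_arc \<kappa> c i x)\<^sup>2) (at x)"
      by (auto intro!: derivative_eq_intros DERIV_trig_arc DERIV_trig_arc' simp: field_simps power2_eq_square)
  next
    fix d :: "nat \<Rightarrow> real" assume "d n = d 0"
    \<comment> \<open>Dividing by \<open>c\<close> turns the boundary terms of
      \<open>vform \<kappa> c d'\<close> into those of the logarithmic derivative with weights
      \<open>d\<close>; the vertex condition then holds with equality.\<close>
    define d' where "d' i = d i / c i" for i
    have "vform \<kappa> c d' = 0" using \<open>d n = d 0\<close> c by (intro crit) (simp add: d'_def)
    moreover have "vform \<kappa> c d' =
      (\<Sum>i<n. trig_arc' \<kappa> c i (p (Suc i)) / trig_arc \<kappa> c i (p (Suc i)) * d (Suc i) - trig_arc' \<kappa> c i (p i) / trig_arc \<kappa> c i (p i) * d i)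
      + \<alpha> * (\<Sum>i\<in>J. d i)"
      unfolding vform_def
    proof (intro arg_cong2[of _ _ _ _ "(+)"] sum.cong arg_cong2[of _ _ _ _ "(*)"] refl)
      fix i assume "i \<in> {..<n}"
      then have i: "i < n" by simp
      show "((c i * d' i + c (Suc i) * d' (Suc i)) * cos (\<kappa> * gap i) - c i * d' (Suc i) - c (Suc i) * d' i) / sinhat \<kappa> (gap i)
        = trig_arc' \<kappa> c i (p (Suc i)) / trig_arc \<kappa> c i (p (Suc i)) * d (Suc i) - trig_arc' \<kappa> c i (p i) / trig_arc \<kappa> c i (p i) * d i"
        unfolding trig_arc_boundary(3)[OF \<kappa>(1) i \<kappa>(2)[OF i], symmetric]
        using trig_arc_boundary(1,2)[OF \<kappa>(1) i \<kappa>(2)[OF i]] by (simp add: d'_def)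
    next
      fix i assume "i \<in> J"
      then have "0 < c i" using c J_subset by auto
      then show "c i * d' i = d i" by (simp add: d'_def)
    qed
    ultimately show "0 \<le> (\<Sum>i<n. trig_arc' \<kappa> c i (p (Suc i)) / trig_arc \<kappa> c i (p (Suc i)) * d (Suc i)
        - trig_arc' \<kappa> c i (p i) / trig_arc \<kappa> c i (p i) * d i) + \<alpha> * (\<Sum>i\<in>J. d i)" by simp
  qed
qed

end

lemma continuous_on_sinhat: "continuous_on S (\<lambda>\<kappa>. sinhat \<kappa> h)"
proof (intro continuous_at_imp_continuous_on ballI)
  fix \<kappa> :: real
  show "isCont (\<lambda>\<kappa>. sinhat \<kappa> h) \<kappa>"
  proof (cases "\<kappa> = 0")
    case True
    have "((\<lambda>x. sin (x * h)) has_real_derivative h) (at 0)"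
      by (auto intro!: derivative_eq_intros)
    then have "((\<lambda>x. sin (x * h) / x) \<longlongrightarrow> h) (at 0)"
      by (simp add: DERIV_def)
    then have "((\<lambda>x. sinhat x h) \<longlongrightarrow> h) (at 0)"
      by (rule Lim_transform_eventually) (auto simp: sinhat_def eventually_at_filter)
    then show ?thesis using True by (simp add: isCont_def sinhat_def)
  next
    case False
    have "\<forall>\<^sub>F x in nhds \<kappa>. x \<noteq> 0"
      using False by (intro t1_space_nhds) auto
    then have ev: "\<forall>\<^sub>F x in nhds \<kappa>. sin (x * h) / x = sinhat x h"
      by eventually_elim (simp add: sinhat_def)
    moreover have "isCont (\<lambda>x. sin (x * h) / x) \<kappa>"
      using False by (intro continuous_intros)
    ultimately show ?thesis by (simp add: isCont_cong[OF ev])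
  qed
qed

section \<open>Degeneration of the vertex form and existence of the least eigenvalue\<close>

context mesh
begin

lemma vform_cong:
  assumes "\<And>i. i \<le> n \<Longrightarrow> c i = c' i" "\<And>i. i \<le> n \<Longrightarrow> d i = d' i"
  shows "vform \<kappa> c d = vform \<kappa> c' d'"
proof -
  have "i \<le> n" if "i \<in> J" for i using that J_subset by auto
  then show ?thesis
    unfolding vform_def using assms by (intro arg_cong2[of _ _ _ _ "(+)"] arg_cong2[of _ _ _ _ "(*)"] sum.cong) auto
qed

lemma vform_add_scale:
  "vform \<kappa> (\<lambda>i. c i + t * d i) (\<lambda>i. c i + t * d i) = vform \<kappa> c c + 2 * t * vform \<kappa> c d + t\<^sup>2 * vform \<kappa> d d"
proof -
  have a: "((\<Sum>i<n. A i) + \<alpha> * A') + 2 * t * ((\<Sum>i<n. B i) + \<alpha> * B') + t\<^sup>2 * ((\<Sum>i<n. C i) + \<alpha> * C')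
    = (\<Sum>i<n. A i + 2 * t * B i + t\<^sup>2 * C i) + \<alpha> * (A' + 2 * t * B' + t\<^sup>2 * C')" for A B C and A' B' C' :: real
    by (simp only: sum.distrib flip: sum_distrib_left) (simp add: algebra_simps)
  have b: "(\<Sum>i\<in>J. c i * c i) + 2 * t * (\<Sum>i\<in>J. c i * d i) + t\<^sup>2 * (\<Sum>i\<in>J. d i * d i)
    = (\<Sum>i\<in>J. (c i + t * d i) * (c i + t * d i))"
    by (simp add: sum.distrib sum_distrib_left algebra_simps power2_eq_square)
  show ?thesis
    unfolding vform_def a b
    by (intro arg_cong2[of _ _ _ _ "(+)"] sum.cong refl)
       (simp add: field_simps power2_eq_square flip: add_divide_distrib)
qed

lemma vform_scale: "vform \<kappa> (\<lambda>i. t * d i) (\<lambda>i. t * d i) = t\<^sup>2 * vform \<kappa> d d"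
  using vform_add_scale[of \<kappa> "\<lambda>_. 0" t d] by (simp add: vform_def)

text \<open>The box also confines the coordinates beyond \<open>n\<close>, which
  \<open>vform\<close> ignores; this gives compactness in the product topology on all
  sequences.\<close>

definition unit_cycles :: "(nat \<Rightarrow> real) set"
  where "unit_cycles = {c. (\<forall>i. c i \<in> {-1..1}) \<and> c n = c 0 \<and> (\<Sum>i<n. (c i)\<^sup>2) = 1}"

lemma compact_unit_cycles: "compact unit_cycles"
proof -
  have "compactin (product_topology (\<lambda>_. euclidean) UNIV) (PiE UNIV (\<lambda>_::nat. {-1..1::real}))"
    by (simp add: compactin_PiE)
  then have "compact (PiE UNIV (\<lambda>_::nat. {-1..1::real}))"
    unfolding euclidean_product_topology compactin_euclidean_iff .
  moreover have "closed {c :: nat \<Rightarrow> real. c n = c 0}"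
    by (intro closed_Collect_eq continuous_on_product_coordinates)
  moreover have "closed {c :: nat \<Rightarrow> real. (\<Sum>i<n. (c i)\<^sup>2) = 1}"
    by (intro closed_Collect_eq continuous_intros continuous_on_product_coordinates)
  ultimately have "compact (PiE UNIV (\<lambda>_::nat. {-1..1::real}) \<inter> {c. c n = c 0} \<inter> {c. (\<Sum>i<n. (c i)\<^sup>2) = 1})"
    by (intro compact_Int_closed)
  also have "\<dots> = unit_cycles"
    by (auto simp: unit_cycles_def PiE_UNIV_domain)
  finally show ?thesis .
qed

text \<open>Neither \<open>c'\<close> nor \<open>r\<close> depends on \<kappa>, so signs of the form
  along a whole range of \<kappa> can be read off on the compact set.\<close>

lemma normalize_cycle:
  assumes "c n = c 0" and "\<exists>i\<le>n. c i \<noteq> 0"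
  obtains c' r where "c' \<in> unit_cycles" "0 < r" "\<And>\<kappa>. vform \<kappa> c c = r * vform \<kappa> c' c'"
proof -
  define s where "s = sqrt (\<Sum>i<n. (c i)\<^sup>2)"
  obtain k where k: "k < n" "c k \<noteq> 0" using assms n_pos by (metis le_neq_implies_less)
  have le: "(c i)\<^sup>2 \<le> (\<Sum>i<n. (c i)\<^sup>2)" if "i < n" for i
    using that by (intro member_le_sum) auto
  have "0 < (c k)\<^sup>2" using k by simp
  then have pos: "0 < (\<Sum>i<n. (c i)\<^sup>2)" using le[OF k(1)] by linarith
  then have s: "0 < s" "s\<^sup>2 = (\<Sum>i<n. (c i)\<^sup>2)" by (auto simp: s_def)
  have bound: "\<bar>c i\<bar> \<le> s" if "i \<le> n" for i
  proof -
    have "\<bar>c i\<bar> \<le> s" if "i < n" for i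
      using le[OF that] unfolding s_def by (metis real_sqrt_abs real_sqrt_le_iff)
    then show ?thesis using that assms n_pos by (cases "i = n") auto
  qed
  define c' where "c' i = (if i \<le> n then c i / s else 0)" for i
  show thesis
  proof (rule that[of c' "s\<^sup>2"])
    have "(\<Sum>i<n. (c' i)\<^sup>2) = (\<Sum>i<n. (c i)\<^sup>2) / s\<^sup>2"
      unfolding sum_divide_distrib by (rule sum.cong) (auto simp: c'_def power_divide)
    then have "(\<Sum>i<n. (c' i)\<^sup>2) = 1" using s pos by simp
    moreover have "c' i \<in> {-1..1}" for i
      using bound[of i] s(1) by (auto simp: c'_def field_simps abs_le_iff)
    ultimately show "c' \<in> unit_cycles" using assms(1) by (simp add: unit_cycles_def c'_def)
    show "0 < s\<^sup>2" using s(1) by (rule zero_less_power)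
    fix \<kappa>
    have "vform \<kappa> c c = vform \<kappa> (\<lambda>i. s * c' i) (\<lambda>i. s * c' i)"
      using s(1) by (intro vform_cong) (auto simp: c'_def)
    then show "vform \<kappa> c c = s\<^sup>2 * vform \<kappa> c' c'" by (simp add: vform_scale)
  qed
qed

text \<open>At \<kappa> = 0 the arcs contribute squared differences: vanishing forces a constant
  sequence, and one repulsive interaction forces the constant to be 0.\<close>

lemma vform_zero_pos:
  assumes "0 < \<alpha>" "J \<noteq> {}" "c \<in> unit_cycles"
  shows "0 < vform 0 c c"
proof (rule ccontr)
  have eq: "vform 0 c c = (\<Sum>i<n. (c i - c (Suc i))\<^sup>2 / gap i) + \<alpha> * (\<Sum>i\<in>J. (c i)\<^sup>2)"
    by (simp add: vform_def sinhat_def power2_eq_square algebra_simps)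
  have nn: "0 \<le> (\<Sum>i<n. (c i - c (Suc i))\<^sup>2 / gap i)" "0 \<le> (\<Sum>i\<in>J. (c i)\<^sup>2)"
    using gap_pos by (auto intro!: sum_nonneg divide_nonneg_pos)
  assume "\<not> 0 < vform 0 c c"
  then have z1: "(\<Sum>i<n. (c i - c (Suc i))\<^sup>2 / gap i) = 0" and z2: "(\<Sum>i\<in>J. (c i)\<^sup>2) = 0"
    using nn mult_nonneg_nonneg[OF less_imp_le[OF assms(1)] nn(2)] assms(1) unfolding eq
    by (auto simp: not_less add_nonneg_eq_0_iff dest!: order_antisym[OF _ add_nonneg_nonneg])
  have "(c i - c (Suc i))\<^sup>2 / gap i = 0" if "i < n" for i
    using z1 that gap_pos by (subst (asm) sum_nonneg_eq_0_iff) (auto intro!: divide_nonneg_pos)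
  then have "c (Suc i) = c i" if "i < n" for i
    using gap_pos[OF that] that by fastforce
  then have const: "i \<le> n \<Longrightarrow> c i = c 0" for i by (induction i) auto
  obtain k where k: "k \<in> J" using assms(2) by blast
  then have "(c k)\<^sup>2 = 0"
    using z2 finite_J by (subst (asm) sum_nonneg_eq_0_iff) auto
  then have "c 0 = 0" using const[of k] k J_subset by auto
  then have "c i = 0" if "i < n" for i using const[of i] that by simp
  then have "(\<Sum>i<n. (c i)\<^sup>2) = 0" by simp
  then show False using assms(3) by (simp add: unit_cycles_def)
qed

text \<open>The off-diagonal coefficients are negative as long as \<open>sinhat\<close> is positive.
  This is the discrete form of the argument that a ground state may be taken nonnegative.\<close>

lemma vform_abs_le:
  assumes "0 \<le> \<kappa>" "\<And>i. i < n \<Longrightarrow> \<kappa> * gap i < pi"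
  shows "vform \<kappa> (\<lambda>i. \<bar>c i\<bar>) (\<lambda>i. \<bar>c i\<bar>) \<le> vform \<kappa> c c"
  unfolding vform_def
proof (intro add_mono sum_mono)
  fix i assume "i \<in> {..<n}"
  then have i: "i < n" by simp
  have s: "0 < sinhat \<kappa> (gap i)" by (rule sinhat_pos[OF assms(1) gap_pos[OF i] assms(2)[OF i]])
  have "c i * c (Suc i) \<le> \<bar>c i\<bar> * \<bar>c (Suc i)\<bar>" by (metis abs_ge_self abs_mult)
  then show "((\<bar>c i\<bar> * \<bar>c i\<bar> + \<bar>c (Suc i)\<bar> * \<bar>c (Suc i)\<bar>) * cos (\<kappa> * gap i) - \<bar>c i\<bar> * \<bar>c (Suc i)\<bar> - \<bar>c (Suc i)\<bar> * \<bar>c i\<bar>) / sinhat \<kappa> (gap i)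
    \<le> ((c i * c i + c (Suc i) * c (Suc i)) * cos (\<kappa> * gap i) - c i * c (Suc i) - c (Suc i) * c i) / sinhat \<kappa> (gap i)"
    using s by (intro divide_right_mono) (auto simp: mult.commute)
qed auto

lemma continuous_on_vform:
  assumes "\<And>i. i < n \<Longrightarrow> K * gap i < pi"
  shows "continuous_on ({0..K} \<times> UNIV) (\<lambda>z. vform (fst z) (snd z) (snd z))"
proof -
  have [continuous_intros]: "continuous_on S (\<lambda>z::real \<times> (nat \<Rightarrow> real). snd z i)" for S i
    by (rule continuous_on_compose2[where g = "\<lambda>f. f i" and f = snd and t = UNIV])
       (rule continuous_on_product_coordinates continuous_on_snd[OF continuous_on_id] | simp)+
  have [continuous_intros]: "continuous_on S (\<lambda>z::real \<times> (nat \<Rightarrow> real). sinhat (fst z) h)" for S h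
    by (rule continuous_on_compose2[OF continuous_on_sinhat[of UNIV]]) (auto intro!: continuous_intros)
  have "sinhat (fst z) (gap i) \<noteq> 0" if "i < n" "z \<in> {0..K} \<times> (UNIV :: (nat \<Rightarrow> real) set)" for i z
  proof -
    have "fst z * gap i \<le> K * gap i"
      using that gap_pos[OF that(1)] by (intro mult_right_mono) auto
    then have "fst z * gap i < pi" using assms[OF that(1)] by simp
    then show ?thesis using sinhat_pos[of "fst z" "gap i"] gap_pos[OF that(1)] that(2) by auto
  qed
  then show ?thesis
    unfolding vform_def by (intro continuous_intros) auto
qed

lemma exists_least_eigenvalue:
  assumes \<alpha>: "0 < \<alpha>" and J: "J \<noteq> {}" and K: "0 \<le> K" "\<And>i. i < n \<Longrightarrow> K * gap i < pi"
    and c: "c n = c 0" "\<exists>i\<le>n. c i \<noteq> 0" "vform K c c \<le> 0"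
  obtains \<kappa> where "0 < \<kappa>" "\<kappa> \<le> K" "is_eigenvalue (delta_operator \<alpha> (p ` J)) (of_real (\<kappa>\<^sup>2))"
    "\<And>\<mu>. is_eigenvalue (delta_operator \<alpha> (p ` J)) (of_real \<mu>) \<Longrightarrow> \<kappa>\<^sup>2 \<le> \<mu>"
proof -
  \<comment> \<open>\<open>\<kappa>\<close> is the smallest value at which the vertex form is not positive definite. At a null vector
    the form is then critical, and taking absolute values makes that vector nonnegative.\<close>
  define S where "S = {0..K} \<times> unit_cycles"
  define E where "E = S \<inter> (\<lambda>z. vform (fst z) (snd z) (snd z)) -` {..0}"
  have "compact S" unfolding S_def by (intro compact_Times compact_unit_cycles) auto
  moreover have cont: "continuous_on S (\<lambda>z. vform (fst z) (snd z) (snd z))"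
    unfolding S_def by (rule continuous_on_subset[OF continuous_on_vform[OF K(2)]]) auto
  then have "closedin (top_of_set S) E"
    unfolding E_def by (rule continuous_closedin_preimage) simp
  ultimately have cE: "compact E" by (rule closedin_compact)
  obtain c1 r where "c1 \<in> unit_cycles" "0 < r" "\<And>\<kappa>. vform \<kappa> c c = r * vform \<kappa> c1 c1"
    using normalize_cycle[OF c(1,2)] by blast
  then have "(K, c1) \<in> E"
    using c(3) K by (auto simp: E_def S_def mult_le_0_iff)
  then have "E \<noteq> {}" by auto
  then obtain z where z: "z \<in> E" "\<And>y. y \<in> E \<Longrightarrow> fst z \<le> fst y"
    using continuous_attains_inf[OF cE _ continuous_on_fst[OF continuous_on_id]] by auto
  define \<kappa> where "\<kappa> = fst z"
  define c0 where "c0 i = \<bar>snd z i\<bar>" for i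
  have \<kappa>: "0 \<le> \<kappa>" "\<kappa> \<le> K" and zc: "snd z \<in> unit_cycles" and z0: "vform \<kappa> (snd z) (snd z) \<le> 0"
    using z(1) by (auto simp: E_def S_def \<kappa>_def)
  have "\<kappa> \<noteq> 0" using vform_zero_pos[OF \<alpha> J zc] z0 by auto
  then have \<kappa>pos: "0 < \<kappa>" using \<kappa> by simp
  have \<kappa>gap: "\<kappa> * gap i < pi" if "i < n" for i
    using mult_right_mono[OF \<kappa>(2) less_imp_le[OF gap_pos[OF that]]] K(2)[OF that] by linarith
  have c0U: "c0 \<in> unit_cycles" using zc by (auto simp: unit_cycles_def c0_def abs_le_iff)
  have c0n: "c0 n = c0 0" using c0U by (simp add: unit_cycles_def)
  have le0: "vform \<kappa> c0 c0 \<le> 0"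
    unfolding c0_def using vform_abs_le[OF \<kappa>(1) \<kappa>gap, of "snd z"] z0 by simp
  \<comment> \<open>Below \<kappa> the form is positive on \<open>unit_cycles\<close>, since
    \<kappa> is the least first coordinate in \<open>E\<close>; semidefiniteness at \<kappa> follows
    by continuity from the left.\<close>
  have nonneg: "0 \<le> vform \<kappa> d d" if d: "d n = d 0" for d
  proof (cases "\<exists>i\<le>n. d i \<noteq> 0")
    case True
    then obtain d1 r where d1: "d1 \<in> unit_cycles" "0 < r" "\<And>\<kappa>. vform \<kappa> d d = r * vform \<kappa> d1 d1"
      using normalize_cycle[of d] d by metis
    have "continuous_on {0..\<kappa>} (\<lambda>k. vform (fst (k, d1)) (snd (k, d1)) (snd (k, d1)))"
      by (rule continuous_on_compose2[OF cont]) (use d1 \<kappa> in \<open>auto simp: S_def intro!: continuous_intros\<close>)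
    then have "((\<lambda>k. vform k d1 d1) \<longlongrightarrow> vform \<kappa> d1 d1) (at \<kappa> within {0..\<kappa>})"
      using \<kappa> by (simp add: continuous_on_def)
    then have lim: "((\<lambda>k. vform k d1 d1) \<longlongrightarrow> vform \<kappa> d1 d1) (at_left \<kappa>)"
      using at_within_Icc_at_left[OF \<kappa>pos] by simp
    have "\<forall>\<^sub>F k in at_left \<kappa>. 0 \<le> vform k d1 d1"
    proof (rule eventually_at_leftI[OF _ \<kappa>pos])
      fix k assume k: "k \<in> {0<..<\<kappa>}"
      then have "(k, d1) \<notin> E" using z(2)[of "(k, d1)"] by (auto simp: \<kappa>_def)
      then show "0 \<le> vform k d1 d1" using k \<kappa> d1(1) by (auto simp: E_def S_def)
    qed
    then have "0 \<le> vform \<kappa> d1 d1"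
      by (rule tendsto_lowerbound[OF lim]) simp
    then show ?thesis using d1 by simp
  next
    case False
    then have "vform \<kappa> d d = vform \<kappa> (\<lambda>_. 0) (\<lambda>_. 0)" by (intro vform_cong) auto
    then show ?thesis by (simp add: vform_def)
  qed
  have zero: "vform \<kappa> c0 c0 = 0" using nonneg[OF c0n] le0 by simp
  have crit: "vform \<kappa> c0 d = 0" if d: "d n = d 0" for d
  proof -
    define B where "B = vform \<kappa> c0 d"
    define D where "D = vform \<kappa> d d"
    have D: "0 \<le> D" unfolding D_def by (rule nonneg[OF d])
    \<comment> \<open>A step against the sign of \<open>B\<close> would make the form negative
      unless \<open>B\<close> is 0. The denominator \<open>D + 1\<close> instead of the optimal
      \<open>D\<close> covers the case \<open>D = 0\<close>.\<close>
    define t where "t = - B / (D + 1)"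
    have tB: "B = - t * (D + 1)" using D by (simp add: t_def)
    have "0 \<le> vform \<kappa> (\<lambda>i. c0 i + t * d i) (\<lambda>i. c0 i + t * d i)"
      by (rule nonneg) (simp add: c0n d)
    then have "0 \<le> 2 * t * B + t\<^sup>2 * D"
      unfolding vform_add_scale zero B_def D_def by simp
    also have "\<dots> = - (t\<^sup>2 * (D + 2))"
      by (simp only: tB) (simp add: power2_eq_square algebra_simps)
    finally have "t\<^sup>2 * (D + 2) \<le> 0" by simp
    then have "t = 0" using D by (auto simp: mult_le_0_iff)
    then have "B = 0" using tB by simp
    then show ?thesis by (simp add: B_def)
  qed
  have c0nn: "0 \<le> c0 i" for i by (simp add: c0_def)
  have zeros: "c0 (Suc i) = 0 \<longleftrightarrow> c0 i = 0" if i: "i < n" for i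
  proof -
    \<comment> \<open>Testing with the indicator of the zero set of \<open>c0\<close> kills all
      diagonal and interaction terms. The remaining terms have one sign, so each vanishes, and a
      zero spreads to its neighbours.\<close>
    define d where "d i = (if c0 i = 0 then 1 else 0 :: real)" for i
    have cd: "c0 i * d i = 0" for i by (simp add: d_def)
    have "vform \<kappa> c0 d = 0" by (rule crit) (simp add: d_def c0n)
    moreover have "vform \<kappa> c0 d = - (\<Sum>i<n. (c0 i * d (Suc i) + c0 (Suc i) * d i) / sinhat \<kappa> (gap i))"
      unfolding vform_def cd sum_negf[symmetric] by (simp, intro sum.cong) (auto simp: minus_divide_left mult.commute)
    ultimately have s0: "(\<Sum>i<n. (c0 i * d (Suc i) + c0 (Suc i) * d i) / sinhat \<kappa> (gap i)) = 0" by simp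
    have sp: "0 < sinhat \<kappa> (gap i)" if "i < n" for i
      by (rule sinhat_pos[OF \<kappa>(1) gap_pos[OF that] \<kappa>gap[OF that]])
    have dnn: "0 \<le> c0 i * d j" for i j using c0nn by (simp add: d_def)
    have "\<forall>i\<in>{..<n}. (c0 i * d (Suc i) + c0 (Suc i) * d i) / sinhat \<kappa> (gap i) = 0"
      using s0 sp by (subst (asm) sum_nonneg_eq_0_iff) (auto intro!: divide_nonneg_pos add_nonneg_nonneg dnn)
    then have "c0 i * d (Suc i) + c0 (Suc i) * d i = 0" using i sp[OF i] by auto
    then have "c0 i * d (Suc i) = 0" "c0 (Suc i) * d i = 0"
      using dnn[of i "Suc i"] dnn[of "Suc i" i] by linarith+
    then show ?thesis by (auto simp: d_def split: if_splits)
  qed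
  have "i \<le> n \<Longrightarrow> c0 i = 0 \<longleftrightarrow> c0 0 = 0" for i
    by (induction i) (auto simp: zeros)
  moreover have "\<exists>i<n. c0 i \<noteq> 0"
  proof (rule ccontr)
    assume "\<not> (\<exists>i<n. c0 i \<noteq> 0)"
    then have "(\<Sum>i<n. (c0 i)\<^sup>2) = 0" by simp
    then show False using c0U by (simp add: unit_cycles_def)
  qed
  ultimately have "c0 i \<noteq> 0" if "i \<le> n" for i using that by (metis less_imp_le_nat)
  then have c0pos: "0 < c0 i" if "i \<le> n" for i
    using that c0nn[of i] by (simp add: less_le)
  show thesis
    by (rule that[OF \<kappa>pos \<kappa>(2)]) (rule least_eigenvalue[OF \<kappa>pos \<kappa>gap c0n c0pos crit]; assumption)+
qed


text \<open>\<open>e\<close> is the vertex vector of a Dirichlet sine spread over the arcs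
  \<open>a\<close> and \<open>b\<close>, scaled to 1 at their common vertex. Its form is a sum of
  two cotangents whose arguments add up to \<pi>. The conditions on \<open>e\<close> also admit a
  common vertex at the cut, which has the two indices \<open>0\<close> and \<open>n\<close>.\<close>

lemma vform_two_arcs:
  assumes \<kappa>: "0 < \<kappa>" "\<kappa> * (gap a + gap b) = pi" and ab: "a < n" "b < n" "a \<noteq> b"
    and e: "\<And>i. i < n \<Longrightarrow> e i * e (Suc i) = 0"
      "\<And>i. i < n \<Longrightarrow> e i * e i + e (Suc i) * e (Suc i) = (if i = a \<or> i = b then 1 else 0)"
      "\<And>i. i \<in> J \<Longrightarrow> e i = 0"
  shows "vform \<kappa> e e = 0"
proof -
  have "vform \<kappa> e e = (\<Sum>i<n. if i = a \<or> i = b then cos (\<kappa> * gap i) / sinhat \<kappa> (gap i) else 0)"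
  proof -
    have "((e i * e i + e (Suc i) * e (Suc i)) * cos (\<kappa> * gap i) - e i * e (Suc i) - e (Suc i) * e i) / sinhat \<kappa> (gap i)
      = (if i = a \<or> i = b then cos (\<kappa> * gap i) / sinhat \<kappa> (gap i) else 0)" if "i < n" for i
      using e(1)[OF that] by (simp add: e(2)[OF that] mult.commute)
    then show ?thesis unfolding vform_def by (simp add: e(3))
  qed
  also have "\<dots> = (\<Sum>i\<in>{a, b}. cos (\<kappa> * gap i) / sinhat \<kappa> (gap i))"
    using ab by (intro sum.mono_neutral_cong_right) auto
  also have "\<dots> = cos (\<kappa> * gap a) / sinhat \<kappa> (gap a) + cos (\<kappa> * gap b) / sinhat \<kappa> (gap b)"
    using ab by simp
  also have "\<kappa> * gap b = pi - \<kappa> * gap a"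
    using \<kappa>(2) by (simp add: algebra_simps)
  also have "sinhat \<kappa> (gap b) = sinhat \<kappa> (gap a)"
    using \<kappa>(1) \<open>\<kappa> * gap b = pi - \<kappa> * gap a\<close> by (simp add: sinhat_def)
  finally show ?thesis by simp
qed

end

section \<open>Gaps between the points of the loop\<close>

lemma lambda1_eqI:
  assumes "is_eigenvalue (delta_operator \<alpha> Y) (of_real \<mu>)"
    and "\<And>\<nu>. is_eigenvalue (delta_operator \<alpha> Y) (of_real \<nu>) \<Longrightarrow> \<mu> \<le> \<nu>"
  shows "lambda1 \<alpha> Y = \<mu>"
  unfolding lambda1_def using assms by (rule Least_equality)

definition loop_gap :: "nat \<Rightarrow> (nat \<Rightarrow> real) \<Rightarrow> nat \<Rightarrow> real"
  where "loop_gap N y j = (if j = N then 2 * pi - y N + y 1 else y (Suc j) - y j)"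

text \<open>
  Halving the arcs keeps \<open>\<kappa>\<close> times the mesh width below \<open>\<pi>\<close> up to \<open>\<kappa> = \<pi> / (largest gap)\<close>; the point
  \<open>0\<close> serves as the inner vertex of the arc from \<open>y N\<close> to \<open>y 1\<close>. The interactions sit at the odd vertices.
\<close>

definition midpoint_mesh :: "nat \<Rightarrow> (nat \<Rightarrow> real) \<Rightarrow> nat \<Rightarrow> real"
  where "midpoint_mesh N y i = (if i = 0 then 0 else if i = 2 * N then 2 * pi
    else if odd i then y (Suc (i div 2)) else (y (i div 2) + y (Suc (i div 2))) / 2)"

definition odd_vertices :: "nat \<Rightarrow> nat set"
  where "odd_vertices N = (\<lambda>j. Suc (2 * j)) ` {..<N}"

locale loop_points =
  fixes N :: nat and y :: "nat \<Rightarrow> real"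
  assumes N2: "2 \<le> N" and y_mono: "strict_mono_on {1..N} y" and y_1: "0 < y 1" and y_N: "y N < 2 * pi"
begin

lemma y_less_Suc: "1 \<le> j \<Longrightarrow> j < N \<Longrightarrow> y j < y (Suc j)"
  using y_mono by (auto simp: strict_mono_on_def)

lemma loop_gap_pos: "j \<in> {1..N} \<Longrightarrow> 0 < loop_gap N y j"
  using y_less_Suc[of j] y_1 y_N by (auto simp: loop_gap_def)

lemma midpoint_mesh_simps:
  "midpoint_mesh N y 0 = 0" "midpoint_mesh N y (2 * N) = 2 * pi"
  "midpoint_mesh N y (Suc (2 * j)) = y (Suc j)"
  "1 \<le> j \<Longrightarrow> j < N \<Longrightarrow> midpoint_mesh N y (2 * j) = (y j + y (Suc j)) / 2"
  using N2 by (auto simp: midpoint_mesh_def) presburger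

lemma midpoint_mesh_gap:
  "midpoint_mesh N y (Suc 0) - midpoint_mesh N y 0 = y 1"
  "midpoint_mesh N y (2 * N) - midpoint_mesh N y (2 * N - 1) = 2 * pi - y N"
  "1 \<le> j \<Longrightarrow> j < N \<Longrightarrow> midpoint_mesh N y (2 * j) - midpoint_mesh N y (2 * j - 1) = loop_gap N y j / 2"
  "1 \<le> j \<Longrightarrow> j < N \<Longrightarrow> midpoint_mesh N y (Suc (2 * j)) - midpoint_mesh N y (2 * j) = loop_gap N y j / 2"
proof -
  have prev: "midpoint_mesh N y (2 * j - 1) = y j" if "1 \<le> j" for j
  proof -
    obtain i where "j = Suc i" using \<open>1 \<le> j\<close> by (cases j) auto
    then show ?thesis using midpoint_mesh_simps(3)[of i] by simp
  qed
  show "midpoint_mesh N y (Suc 0) - midpoint_mesh N y 0 = y 1"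
    using midpoint_mesh_simps(3)[of 0] midpoint_mesh_simps(1) by simp
  show "midpoint_mesh N y (2 * N) - midpoint_mesh N y (2 * N - 1) = 2 * pi - y N"
    using prev[of N] midpoint_mesh_simps(2) N2 by simp
  show "midpoint_mesh N y (2 * j) - midpoint_mesh N y (2 * j - 1) = loop_gap N y j / 2" if "1 \<le> j" "j < N"
    using prev[of j] midpoint_mesh_simps(4)[OF that] that by (simp add: loop_gap_def field_simps)
  show "midpoint_mesh N y (Suc (2 * j)) - midpoint_mesh N y (2 * j) = loop_gap N y j / 2" if "1 \<le> j" "j < N"
    using midpoint_mesh_simps(3)[of j] midpoint_mesh_simps(4)[OF that] that by (simp add: loop_gap_def field_simps)
qed

lemma arc_cases:
  assumes "i < 2 * N"
  obtains "i = 0" | "i = 2 * N - 1" | j where "1 \<le> j" "j < N" "i = 2 * j - 1" | j where "1 \<le> j" "j < N" "i = 2 * j"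
proof (cases "even i")
  case True
  then obtain j where j: "i = 2 * j" by (elim evenE)
  show thesis
  proof (cases "j = 0")
    case True
    then show thesis using j by (intro that(1)) simp
  next
    case False
    then show thesis using j assms by (intro that(4)[of j]) auto
  qed
next
  case False
  then obtain j where j: "i = 2 * j + 1" by (elim oddE)
  show thesis
  proof (cases "Suc j = N")
    case True
    then show thesis using j by (intro that(2)) auto
  next
    case False
    then show thesis using j assms by (intro that(3)[of "Suc j"]) auto
  qed
qed

text \<open>The strict upper bound is the purpose of the extra vertices: with \<open>L\<close> the
  largest gap, it keeps \<open>pi / L\<close> times every mesh arc below \<pi>. The gap through 0 is
  split unevenly, but both pieces have positive length.\<close>

lemma midpoint_mesh_gap_bounds:
  assumes "i < 2 * N" and max: "\<And>j. j \<in> {1..N} \<Longrightarrow> loop_gap N y j \<le> L"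
  shows "0 < midpoint_mesh N y (Suc i) - midpoint_mesh N y i"
    and "midpoint_mesh N y (Suc i) - midpoint_mesh N y i < L"
proof -
  have L: "2 * pi - y N + y 1 \<le> L" using max[of N] N2 by (simp add: loop_gap_def)
  have "0 < midpoint_mesh N y (Suc i) - midpoint_mesh N y i \<and> midpoint_mesh N y (Suc i) - midpoint_mesh N y i < L"
    using assms(1)
  proof (cases rule: arc_cases)
    case 1
    then show ?thesis using midpoint_mesh_gap(1) y_1 y_N L by simp
  next
    case 2
    then have "Suc i = 2 * N" using N2 by simp
    then show ?thesis using 2 midpoint_mesh_gap(2) y_1 y_N L by simp
  next
    case (3 j)
    then have "Suc i = 2 * j" by simp
    then show ?thesis using 3 midpoint_mesh_gap(3)[of j] loop_gap_pos[of j] max[of j] by simp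
  next
    case (4 j)
    then show ?thesis using midpoint_mesh_gap(4)[of j] loop_gap_pos[of j] max[of j] by simp
  qed
  then show "0 < midpoint_mesh N y (Suc i) - midpoint_mesh N y i"
    "midpoint_mesh N y (Suc i) - midpoint_mesh N y i < L" by auto
qed

lemma mesh_midpoint: "mesh (2 * N) (midpoint_mesh N y) (odd_vertices N)"
proof
  show "midpoint_mesh N y i < midpoint_mesh N y (Suc i)" if "i < 2 * N" for i
    using midpoint_mesh_gap_bounds(1)[OF that, of "Max (loop_gap N y ` {1..N})"] by auto
qed (use N2 midpoint_mesh_simps in \<open>auto simp: odd_vertices_def\<close>)

lemma midpoint_mesh_vertices: "midpoint_mesh N y ` odd_vertices N = y ` {1..N}"
  unfolding odd_vertices_def image_image midpoint_mesh_simps(3)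
  by (simp add: image_Suc_lessThan flip: image_image[of y Suc])

text \<open>The Dirichlet sine on gap \<open>m\<close> makes the vertex form vanish at
  \<open>K\<close>. Maximality of that gap keeps all other arcs within the range where interpolation
  works at \<open>K\<close>.\<close>

lemma least_eigenvalue_le_gap:
  assumes \<alpha>: "0 < \<alpha>" and m: "m \<in> {1..N}" and max: "\<And>j. j \<in> {1..N} \<Longrightarrow> loop_gap N y j \<le> loop_gap N y m"
  obtains \<kappa> where "0 < \<kappa>" "\<kappa> \<le> pi / loop_gap N y m"
    "is_eigenvalue (delta_operator \<alpha> (y ` {1..N})) (of_real (\<kappa>\<^sup>2))" "lambda1 \<alpha> (y ` {1..N}) = \<kappa>\<^sup>2"
proof -
  interpret mesh "2 * N" "midpoint_mesh N y" "odd_vertices N" \<alpha> by (rule mesh_midpoint)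
  define L where "L = loop_gap N y m"
  have L: "0 < L" using loop_gap_pos[OF m] by (simp add: L_def)
  define K where "K = pi / L"
  have K: "0 < K" using L by (simp add: K_def)
  have KL: "K * L = pi" using L by (simp add: K_def)
  have Kgap: "K * gap i < pi" if "i < 2 * N" for i
  proof -
    have "gap i < L" using midpoint_mesh_gap_bounds(2)[OF that max] by (simp add: gap_def L_def)
    then show ?thesis using mult_strict_left_mono[OF _ K] KL by fastforce
  qed
  have ev: "2 * j \<notin> odd_vertices N" for j
    unfolding odd_vertices_def by (auto, presburger)
  have pos: "0 < i" if "i \<in> odd_vertices N" for i
    using that by (auto simp: odd_vertices_def)
  obtain e :: "nat \<Rightarrow> real" where e: "e (2 * N) = e 0" "\<exists>i\<le>2 * N. e i \<noteq> 0" "vform K e e = 0"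
  proof (cases "m = N")
    case True
    \<comment> \<open>This gap runs through the cut, so its inner vertex is both index
      \<open>0\<close> and index \<open>2 * N\<close>.\<close>
    have s: "K * (gap 0 + gap (2 * N - 1)) = pi"
      using midpoint_mesh_gap(1,2) N2 KL True by (simp add: gap_def L_def loop_gap_def add.commute)
    show thesis
    proof (rule that[of "\<lambda>i. if i = 0 \<or> i = 2 * N then 1 else 0"])
      show "vform K (\<lambda>i. if i = 0 \<or> i = 2 * N then 1 else 0) (\<lambda>i. if i = 0 \<or> i = 2 * N then 1 else 0) = 0"
        by (rule vform_two_arcs[OF K s]) (use N2 pos ev[of N] in auto)
    qed auto
  next
    case False
    then have m': "1 \<le> m" "m < N" using m by auto
    have "gap (2 * m - 1) + gap (2 * m) = L"
      using midpoint_mesh_gap(3,4)[OF m'] m' by (simp add: gap_def L_def)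
    then have s: "K * (gap (2 * m - 1) + gap (2 * m)) = pi" using KL by simp
    show thesis
    proof (rule that[of "\<lambda>i. if i = 2 * m then 1 else 0"])
      show "vform K (\<lambda>i. if i = 2 * m then 1 else 0) (\<lambda>i. if i = 2 * m then 1 else 0) = 0"
        by (rule vform_two_arcs[OF K s]) (use m' ev in auto)
    qed (use m' in auto)
  qed
  have "odd_vertices N \<noteq> {}" using N2 by (auto simp: odd_vertices_def lessThan_empty_iff)
  then obtain \<kappa> where "0 < \<kappa>" "\<kappa> \<le> K"
    and ev: "is_eigenvalue (delta_operator \<alpha> (y ` {1..N})) (of_real (\<kappa>\<^sup>2))"
    "\<And>\<mu>. is_eigenvalue (delta_operator \<alpha> (y ` {1..N})) (of_real \<mu>) \<Longrightarrow> \<kappa>\<^sup>2 \<le> \<mu>"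
    using exists_least_eigenvalue[OF \<alpha> _ less_imp_le[OF K] Kgap e(1,2)] e(3)
    unfolding midpoint_mesh_vertices by auto
  then show thesis using that lambda1_eqI[OF ev] unfolding K_def L_def by auto
qed

lemma sum_loop_gap: "(\<Sum>j=1..N. loop_gap N y j) = 2 * pi"
proof -
  have "(\<Sum>j=1..N. loop_gap N y j) = (\<Sum>j=1..<N. loop_gap N y j) + loop_gap N y N"
    using N2 by (simp add: sum.last_plus add.commute flip: atLeastLessThanSuc_atLeastAtMost)
  also have "(\<Sum>j=1..<N. loop_gap N y j) = (\<Sum>j=1..<N. y (Suc j) - y j)"
    by (rule sum.cong) (auto simp: loop_gap_def)
  also have "\<dots> = y N - y 1"
    using N2 by (intro sum_Suc_diff') auto
  finally show ?thesis by (simp add: loop_gap_def)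
qed

end

section \<open>Rotations of the loop and an arc longer than average\<close>

definition loop_shift :: "real \<Rightarrow> real \<Rightarrow> real"
  where "loop_shift \<delta> s = (if s + \<delta> < 0 then s + \<delta> + 2 * pi else if s + \<delta> < 2 * pi then s + \<delta> else s + \<delta> - 2 * pi)"

lemma loop_isometry_shift:
  assumes "\<bar>\<delta>\<bar> < 2 * pi"
  shows "loop_isometry (loop_shift \<delta>)"
  unfolding loop_isometry_def
proof (intro conjI ballI)
  show "bij_betw (loop_shift \<delta>) loop loop"
    by (rule bij_betw_byWitness[where f' = "loop_shift (- \<delta>)"])
      (use assms in \<open>auto simp: loop_def loop_shift_def\<close>)
  fix s t assume "s \<in> loop" "t \<in> loop"
  then show "loop_dist (loop_shift \<delta> s) (loop_shift \<delta> t) = loop_dist s t"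
    using assms by (auto simp: loop_def loop_shift_def loop_dist_def min_def abs_if)
qed

context loop_points
begin

text \<open>The gaps have mean \<open>2 * pi / N\<close>. If none exceeds the mean, all equal it,
  and a rotation carries the points onto the equidistant set.\<close>

lemma large_gap:
  assumes "\<not> loop_congruent (y ` {1..N}) (Ytilde N)"
  obtains j where "j \<in> {1..N}" "2 * pi / N < loop_gap N y j"
proof (rule ccontr)
  define h where "h = 2 * pi / N"
  have h: "real N * h = 2 * pi" using N2 by (simp add: h_def)
  assume "\<not> thesis"
  then have le: "loop_gap N y j \<le> h" if "j \<in> {1..N}" for j
    using that \<open>\<And>j. \<lbrakk>j \<in> {1..N}; 2 * pi / N < loop_gap N y j\<rbrakk> \<Longrightarrow> thesis\<close> by (force simp: h_def)
  have "(\<Sum>j=1..N. h - loop_gap N y j) = 0"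
    unfolding sum_subtractf sum_loop_gap using h by simp
  then have "\<forall>j\<in>{1..N}. h - loop_gap N y j = 0"
    by (subst (asm) sum_nonneg_eq_0_iff) (use le in auto)
  then have gap: "loop_gap N y j = h" if "j \<in> {1..N}" for j using that by simp
  have y_eq: "Suc j \<le> N \<Longrightarrow> y (Suc j) = y 1 + real j * h" for j
  proof (induction j)
    case (Suc j)
    then show ?case using gap[of "Suc j"] by (simp add: loop_gap_def algebra_simps)
  qed simp
  \<comment> \<open>The first point of \<open>Ytilde N\<close> is \<open>h / 2\<close>. With this
    rotation no point of the set has to wrap around.\<close>
  define \<delta> where "\<delta> = h / 2 - y 1"
  have "y 1 < h" using gap[of N] y_N N2 by (simp add: loop_gap_def)
  moreover have "h \<le> pi" using N2 pi_gt_zero by (simp add: h_def field_simps)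
  ultimately have \<delta>: "\<bar>\<delta>\<bar> < 2 * pi" using y_1 by (simp add: \<delta>_def abs_if)
  have "loop_shift \<delta> (y j) = pi / real N * (2 * real j - 1)" if j: "j \<in> {1..N}" for j
  proof -
    have e: "y j + \<delta> = h * (real j - 1 / 2)"
      using y_eq[of "j - 1"] j by (simp add: \<delta>_def algebra_simps of_nat_diff)
    have "0 < h" using pi_gt_zero N2 by (simp add: h_def)
    then have "0 \<le> h * (real j - 1 / 2)" using j by (intro mult_nonneg_nonneg) auto
    moreover have "h * (real j - 1 / 2) < 2 * pi"
    proof -
      have "h * (real j - 1 / 2) < h * real N" using \<open>0 < h\<close> j by (intro mult_strict_left_mono) auto
      then show ?thesis using h by (simp add: mult.commute)
    qed
    ultimately have "loop_shift \<delta> (y j) = h * (real j - 1 / 2)"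
      unfolding loop_shift_def e by simp
    then show ?thesis using N2 by (simp add: h_def field_simps)
  qed
  then have "loop_shift \<delta> ` y ` {1..N} = Ytilde N"
    unfolding Ytilde_def image_image by (rule image_cong[OF refl])
  then show False using assms loop_isometry_shift[OF \<delta>] unfolding loop_congruent_def by blast
qed

end

section \<open>Lower bound for the equidistant set and the comparison\<close>

lemma sum_pairs: "(\<Sum>i<2 * N. f i) = (\<Sum>j<N. f (2 * j) + f (Suc (2 * j)))" for f :: "nat \<Rightarrow> 'a::comm_monoid_add"
  by (induction N) (simp_all add: add.assoc)

lemma Ytilde_eigenvalue_bound:
  assumes N: "1 \<le> N" and K: "0 < K" "K < N / 2" and \<alpha>: "2 * K * tan (K * pi / N) \<le> \<alpha>"
    and ev: "is_eigenvalue (delta_operator \<alpha> (Ytilde N)) (of_real \<mu>)"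
  shows "K\<^sup>2 \<le> \<mu>"
proof -
  define h where "h = pi / N"
  have h: "0 < h" using N by (simp add: h_def)
  have Kh: "K * h < pi / 2" using K N by (simp add: h_def field_simps)
  \<comment> \<open>Odd multiples of \<open>h\<close> are the interaction points, even ones the
    midpoints between them.\<close>
  define p where "p i = h * real i" for i
  interpret mesh "2 * N" p "odd_vertices N" \<alpha>
  proof
    show "p (2 * N) = 2 * pi" using N by (simp add: p_def h_def)
  qed (use N h in \<open>auto simp: p_def odd_vertices_def\<close>)
  have Y: "p ` odd_vertices N = Ytilde N"
  proof -
    have "Ytilde N = (\<lambda>j. pi / real N * (2 * real j - 1)) ` Suc ` {..<N}"
      by (simp add: Ytilde_def image_Suc_lessThan)
    then show ?thesis
      unfolding odd_vertices_def image_image p_def h_def by (auto simp: algebra_simps intro!: image_cong)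
  qed
  \<comment> \<open>\<open>m i\<close> is the midpoint, between two interaction points, at one end of the arc \<open>i\<close>; there the
    solution \<open>cos (K (x - m i))\<close> has slope \<open>0\<close>.\<close>
  define m where "m i = p (if even i then i else Suc i)" for i
  define w where "w i x = - K * tan (K * (x - m i))" for i x
  define \<tau> where "\<tau> = tan (K * h)"
  show ?thesis
  proof (rule riccati_eigenvalue_bound[where w = w])
    show "is_eigenvalue (delta_operator \<alpha> (p ` odd_vertices N)) (of_real \<mu>)" using ev Y by simp
  next
    fix i x assume "i < 2 * N" and x: "x \<in> {p i..p (Suc i)}"
    have "\<bar>x - m i\<bar> \<le> h" using x h by (auto simp: m_def p_def algebra_simps)
    then have "K * \<bar>x - m i\<bar> \<le> K * h" using K by (intro mult_left_mono) auto
    then have "\<bar>K * (x - m i)\<bar> < pi / 2" using Kh K by (simp only: abs_mult)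
    then have "0 < cos (K * (x - m i))" by (intro cos_gt_zero_pi) linarith+
    then have c: "cos (K * (x - m i)) \<noteq> 0" by simp
    have "(w i has_real_derivative - K * (inverse ((cos (K * (x - m i)))\<^sup>2) * K)) (at x)"
      unfolding w_def using c by (auto intro!: derivative_eq_intros)
    also have "- K * (inverse ((cos (K * (x - m i)))\<^sup>2) * K) = - K\<^sup>2 - (w i x)\<^sup>2"
    proof -
      have "inverse ((cos (K * (x - m i)))\<^sup>2) = 1 + (tan (K * (x - m i)))\<^sup>2"
        using tan_sec[OF c] by (simp add: power_inverse)
      then show ?thesis by (simp only:) (simp add: w_def power2_eq_square algebra_simps)
    qed
    finally show "(w i has_real_derivative - K\<^sup>2 - (w i x)\<^sup>2) (at x)" .
  next
    fix d :: "nat \<Rightarrow> real" assume d: "\<And>i. 0 \<le> d i"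
    \<comment> \<open>Midpoints contribute nothing; each interaction point receives
      \<open>- K * \<tau>\<close> from either side, which is the origin of the threshold for
      \<alpha>.\<close>
    have t: "w (2 * j) (p (Suc (2 * j))) = - K * \<tau>" "w (2 * j) (p (2 * j)) = 0"
      "w (Suc (2 * j)) (p (Suc (Suc (2 * j)))) = 0" "w (Suc (2 * j)) (p (Suc (2 * j))) = K * \<tau>" for j
      by (simp_all add: w_def m_def p_def \<tau>_def algebra_simps)
    have "(\<Sum>i<2 * N. w i (p (Suc i)) * d (Suc i) - w i (p i) * d i) = (- 2 * K * \<tau>) * (\<Sum>j<N. d (Suc (2 * j)))"
      unfolding sum_pairs t sum_distrib_left by (simp add: algebra_simps)
    moreover have "(\<Sum>i\<in>odd_vertices N. d i) = (\<Sum>j<N. d (Suc (2 * j)))"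
      unfolding odd_vertices_def by (subst sum.reindex) (auto intro: inj_onI)
    ultimately have "(\<Sum>i<2 * N. w i (p (Suc i)) * d (Suc i) - w i (p i) * d i) + \<alpha> * (\<Sum>i\<in>odd_vertices N. d i)
       = (\<alpha> - 2 * K * \<tau>) * (\<Sum>j<N. d (Suc (2 * j)))"
      by (simp only:) (simp add: algebra_simps)
    also have "0 \<le> \<dots>"
      using \<alpha> d by (intro mult_nonneg_nonneg sum_nonneg) (auto simp: \<tau>_def h_def)
    finally show "0 \<le> (\<Sum>i<2 * N. w i (p (Suc i)) * d (Suc i) - w i (p i) * d i) + \<alpha> * (\<Sum>i\<in>odd_vertices N. d i)" .
  qed
qed

theorem theorem5p2:
  fixes N :: nat and y :: "nat \<Rightarrow> real" and Y :: "real set"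
  assumes "N \<ge> 2"
    and "strict_mono_on {1..N} y" and "0 < y 1" and "y N < 2 * pi"
    and "Y = y ` {1..N}"
    and "\<not> loop_congruent Y (Ytilde N)"
  shows "\<exists>\<alpha>1>0. \<forall>\<alpha>>\<alpha>1. lambda1 \<alpha> Y < lambda1 \<alpha> (Ytilde N)"
proof -
  interpret Y: loop_points N y by unfold_locales (use assms in auto)
  let ?z = "\<lambda>j. pi / real N * (2 * real j - 1)"
  interpret Z: loop_points N ?z
    using assms(1) pi_gt_zero by unfold_locales (auto simp: strict_mono_on_def field_simps)
  have N: "0 < real N" using assms(1) by simp
  have "Max (loop_gap N y ` {1..N}) \<in> loop_gap N y ` {1..N}"
    using assms(1) by (intro Max_in) auto
  then obtain m where m: "m \<in> {1..N}" and "loop_gap N y m = Max (loop_gap N y ` {1..N})" by auto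
  then have max: "loop_gap N y j \<le> loop_gap N y m" if "j \<in> {1..N}" for j using that by simp
  define L where "L = loop_gap N y m"
  obtain j where "j \<in> {1..N}" "2 * pi / N < loop_gap N y j"
    using Y.large_gap assms(5,6) by blast
  then have L: "2 * pi / N < L" using max[of j] by (simp add: L_def)
  have L0: "0 < L" using Y.loop_gap_pos[OF m] by (simp add: L_def)
  \<comment> \<open>The room above \<open>pi / L\<close> gives the strict inequality, and the room
    below \<open>N / 2\<close> keeps the tangent in the threshold finite and positive.\<close>
  define K where "K = (pi / L + N / 2) / 2"
  have "pi / L < N / 2" using L L0 N by (simp add: field_simps)
  then have K: "pi / L < K" "K < N / 2" by (auto simp: K_def)
  have K0: "0 < K" using K(1) L0 pi_gt_zero by (meson divide_pos_pos less_trans)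
  define \<alpha>1 where "\<alpha>1 = 2 * K * tan (K * pi / N)"
  have "K * pi / N < pi / 2" using K N by (simp add: field_simps)
  then have "0 < tan (K * pi / N)" using K0 N by (intro tan_gt_zero) auto
  then have \<alpha>1: "0 < \<alpha>1" using K0 by (simp add: \<alpha>1_def)
  show ?thesis
  proof (intro exI conjI allI impI)
    fix \<alpha> assume \<alpha>: "\<alpha>1 < \<alpha>"
    then have "0 < \<alpha>" using \<alpha>1 by simp
    obtain \<kappa> where \<kappa>: "0 < \<kappa>" "\<kappa> \<le> pi / L" "lambda1 \<alpha> Y = \<kappa>\<^sup>2"
      using Y.least_eigenvalue_le_gap[OF \<open>0 < \<alpha>\<close> m max] unfolding L_def assms(5) by blast
    have zgap: "loop_gap N ?z j = 2 * pi / N" for j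
      using N by (simp add: loop_gap_def field_simps)
    \<comment> \<open>The lower bound holds for every eigenvalue; it passes to
      \<open>lambda1\<close> because that number is now known to be an eigenvalue. All gaps of the
      equidistant set are equal, so \<open>m\<close> again indexes a largest one.\<close>
    obtain \<rho> where "is_eigenvalue (delta_operator \<alpha> (Ytilde N)) (of_real (\<rho>\<^sup>2))" "lambda1 \<alpha> (Ytilde N) = \<rho>\<^sup>2"
      using Z.least_eigenvalue_le_gap[OF \<open>0 < \<alpha>\<close> m] unfolding zgap Ytilde_def by blast
    then have "K\<^sup>2 \<le> lambda1 \<alpha> (Ytilde N)"
      using Ytilde_eigenvalue_bound[of N K \<alpha>] assms(1) K K0 \<alpha> by (simp add: \<alpha>1_def)
    moreover have "\<kappa>\<^sup>2 < K\<^sup>2"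
      using \<kappa> K by (intro power_strict_mono) auto
    ultimately show "lambda1 \<alpha> Y < lambda1 \<alpha> (Ytilde N)" using \<kappa>(3) by simp
  qed (rule \<alpha>1)
qed

end
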